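(* Let $\theta_0:\mathbb{R}\to\mathbb{R}$ be smooth, non-constant, decaying at infinity, even, non-negative, and monotone decreasing on $(0,\infty)$. Then the initial value problem $$\partial_t\theta+u\,\partial_x\theta=0,\qquad u=H\theta,\qquad \theta(0,\cdot)=\theta_0,$$ does not have a global in time $C^1_x$ smooth solution.
   Context: $H$ is the Hilbert transform in $x$, $H\theta(x)=\frac1\pi\,\mathrm{p.v.}\int_{\mathbb{R}}\frac{\theta(y)}{y-x}\,dy$. The equation is posed for $(t,x)\in[0,\infty)\times\mathbb{R}$. A global in time $C^1_x$ smooth solution is a classical solution that belongs to $L^\infty(0,T;C^1(\mathbb{R}))$ for every $T>0$. *)

theory Defs
  imports "HOL-Analysis.Analysis"
begin

definition smooth :: "(real \<Rightarrow> real) \<Rightarrow> bool" where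
  "smooth f \<longleftrightarrow> (\<forall>n. (deriv ^^ n) f differentiable_on UNIV)"

text \<open>
  The principal value is taken both at the singularity and at infinity: the integral over
  \<open>\<epsilon> < \<bar>y - x\<bar> < R\<close> has to converge as \<open>\<epsilon> \<rightarrow> 0\<close> and \<open>R \<rightarrow> \<infinity>\<close> independently. No absolute
  integrability at infinity is demanded, because a datum that merely decays need not provide it.
  A relation is used instead of a function so that existence of the limit is part of the assertion.
\<close>

definition has_Hilbert_transform_at :: "(real \<Rightarrow> real) \<Rightarrow> real \<Rightarrow> real \<Rightarrow> bool" where
  "has_Hilbert_transform_at f v x \<longleftrightarrow>
     ((\<lambda>(\<epsilon>, R). 1 / pi * (LINT y:{y. \<epsilon> < \<bar>y - x\<bar> \<and> \<bar>y - x\<bar> < R}|lborel. f y / (y - x)))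
        \<longlongrightarrow> v) (at_right 0 \<times>\<^sub>F at_top)"

text \<open>
  The solution is curried, \<open>\<theta> t x\<close>, and its values at negative times are irrelevant.
  Classical means continuously differentiable on \<open>[0,\<infinity>) \<times> \<real>\<close>, with a one-sided
  time derivative at \<open>t = 0\<close>. Evenness, monotonicity and decay are not required at later times.
\<close>

definition classical_solution :: "(real \<Rightarrow> real) \<Rightarrow> (real \<Rightarrow> real \<Rightarrow> real) \<Rightarrow> bool" where
  "classical_solution \<theta>\<^sub>0 \<theta> \<longleftrightarrow>
     (\<forall>x. \<theta> 0 x = \<theta>\<^sub>0 x) \<and>
     (\<exists>\<theta>\<^sub>t \<theta>\<^sub>x u :: real \<Rightarrow> real \<Rightarrow> real.
        continuous_on ({0..} \<times> UNIV) (\<lambda>(t, x). \<theta> t x) \<and>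
        continuous_on ({0..} \<times> UNIV) (\<lambda>(t, x). \<theta>\<^sub>t t x) \<and>
        continuous_on ({0..} \<times> UNIV) (\<lambda>(t, x). \<theta>\<^sub>x t x) \<and>
        (\<forall>t\<ge>0. \<forall>x.
           ((\<lambda>s. \<theta> s x) has_real_derivative \<theta>\<^sub>t t x) (at t within {0..}) \<and>
           (\<theta> t has_real_derivative \<theta>\<^sub>x t x) (at x) \<and>
           has_Hilbert_transform_at (\<theta> t) (u t x) x \<and>
           \<theta>\<^sub>t t x + u t x * \<theta>\<^sub>x t x = 0))"

text \<open>
  \<open>C\<^sup>1(\<real>)\<close> carries the norm \<open>sup \<bar>f\<bar> + sup \<bar>f'\<bar>\<close>, so an essential bound in time amounts to
  one constant bounding \<open>\<theta>(t,\<cdot>)\<close> and its derivative for almost every \<open>t \<in> (0,T)\<close>.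
\<close>

definition Linf_C1 :: "real \<Rightarrow> (real \<Rightarrow> real \<Rightarrow> real) \<Rightarrow> bool" where
  "Linf_C1 T \<theta> \<longleftrightarrow>
     (\<exists>C. AE t in lborel. t \<in> {0<..<T} \<longrightarrow>
        \<theta> t C1_differentiable_on UNIV \<and> (\<forall>x. \<bar>\<theta> t x\<bar> \<le> C \<and> \<bar>deriv (\<theta> t) x\<bar> \<le> C))"

definition global_C1_solution :: "(real \<Rightarrow> real) \<Rightarrow> (real \<Rightarrow> real \<Rightarrow> real) \<Rightarrow> bool" where
  "global_C1_solution \<theta>\<^sub>0 \<theta> \<longleftrightarrow> classical_solution \<theta>\<^sub>0 \<theta> \<and> (\<forall>T>0. Linf_C1 T \<theta>)"

end

theory Submission
  imports Defs "HOL-Complex_Analysis.Great_Picard"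
begin

text \<open>
  A superlevel set \<open>{\<theta> t \<ge> c} = [l, r]\<close> is carried by the flow, and its width obeys
  \<open>\<pi> (r - l)' = \<integral> (\<theta> t y - c) (r - l) / ((y - r) (y - l)) dy\<close>, whose integrand is nowhere positive. If
  \<open>[L, R]\<close> is the superlevel set of a lower level \<open>b\<close>, the part of the integral beyond \<open>R\<close> already gives
  \<open>\<pi> (r - l)' \<le> - (c - b) (r - l) / (R - L)\<close>. Along a sequence of levels increasing geometrically to the
  maximum, these inequalities force the widths to become much smaller than a Lipschitz profile permits,
  after a time that depends on the datum only.

  No uniqueness for the flow is needed: two trajectories that meet carry the same value of \<open>\<theta>\<close>. For the
  same reason \<open>\<theta> t\<close> need not be known to stay even.
\<close>

subsection \<open>Truncated Hilbert transforms\<close>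

text \<open>For a datum that merely decays, the integral behind \<open>u t x\<close> need not
  converge absolutely: the limit exists pointwise, with no rate and no control in \<open>t\<close>.
  Differences \<open>u t x - u t y\<close> behave better, because the two tails cancel up to a
  factor \<open>|x - y| / R\<close>, with constants depending only on the bound \<open>C\<close>. So
  nearly every quantitative step is about differences, that is, widths of superlevel sets and
  distances between trajectories. The exception is an absolute bound for the velocity at the image
  of the origin, which keeps the picture from drifting to infinity.

  The order of the constants matters. \<open>C\<close> is available only once the time horizon is
  fixed, and may grow with it. The contraction rates therefore contain no \<open>C\<close>; it
  enters the collapse only at the end, as the slope that is exceeded.

  The quotient of level gap by width plays two roles: up to constants it is the decay rate of the
  next width and a lower bound for the slope of the profile. Gaps halve from level to level, so any
  width ratio above 2 makes it grow geometrically; 4 is a convenient choice.\<close>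

definition trunc_Hilbert :: "(real \<Rightarrow> real) \<Rightarrow> real \<Rightarrow> real \<Rightarrow> real \<Rightarrow> real" where
  "trunc_Hilbert f x \<epsilon> R = integral {\<epsilon>..R} (\<lambda>z. (f (x + z) - f (x - z)) / z)"

lemma trunc_Hilbert_split:
  assumes "continuous_on UNIV f" "0 < \<epsilon>"
  shows "trunc_Hilbert f x \<epsilon> R =
    integral {\<epsilon>..R} (\<lambda>z. f (x + z) / z) - integral {\<epsilon>..R} (\<lambda>z. f (x - z) / z)"
proof -
  have "continuous_on {\<epsilon>..R} (\<lambda>z. f (x + z) / z)" "continuous_on {\<epsilon>..R} (\<lambda>z. f (x - z) / z)"
    using assms by (auto intro!: continuous_intros continuous_on_compose2[OF assms(1)])
  then show ?thesis
    unfolding trunc_Hilbert_def diff_divide_distrib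
    by (intro integral_diff integrable_continuous_interval)
qed

lemma annulus_integral_eq_trunc_Hilbert:
  assumes f: "continuous_on UNIV f" and "0 < \<epsilon>" "\<epsilon> < R"
  shows "(LINT y:{y. \<epsilon> < \<bar>y - x\<bar> \<and> \<bar>y - x\<bar> < R}|lborel. f y / (y - x)) = trunc_Hilbert f x \<epsilon> R"
proof -
  define g where "g = (\<lambda>y. f y / (y - x))"
  have set_eq: "{y. \<epsilon> < \<bar>y - x\<bar> \<and> \<bar>y - x\<bar> < R} = {x - R<..<x - \<epsilon>} \<union> {x + \<epsilon><..<x + R}"
    using assms by auto
  have "continuous_on {x - R..x - \<epsilon>} g" "continuous_on {x + \<epsilon>..x + R} g"
    unfolding g_def using assms by (auto intro!: continuous_intros continuous_on_subset[OF f])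
  then have "set_integrable lborel {x - R..x - \<epsilon>} g" "set_integrable lborel {x + \<epsilon>..x + R} g"
    by (auto intro: borel_integrable_atLeastAtMost')
  then have i: "set_integrable lborel {x - R<..<x - \<epsilon>} g" "set_integrable lborel {x + \<epsilon><..<x + R} g"
    by (auto intro: set_integrable_subset[where A="{x - R..x - \<epsilon>}"]
        set_integrable_subset[where A="{x + \<epsilon>..x + R}"])
  have "(LINT y:{y. \<epsilon> < \<bar>y - x\<bar> \<and> \<bar>y - x\<bar> < R}|lborel. g y)
      = integral {x - R..x - \<epsilon>} g + integral {x + \<epsilon>..x + R} g"
    unfolding set_eq using assms(2)
    by (subst set_integral_Un[OF _ i])
       (auto simp: set_borel_integral_eq_integral[OF i(1)] set_borel_integral_eq_integral[OF i(2)]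
         integral_open_interval_real)
  moreover have "integral {x + \<epsilon>..x + R} g = integral {\<epsilon>..R} (\<lambda>z. f (x + z) / z)"
    using integral_shift_real_ivl[of "x + \<epsilon>" x "x + R" g] by (simp add: g_def add.commute)
  moreover have "integral {x - R..x - \<epsilon>} g = - integral {\<epsilon>..R} (\<lambda>z. f (x - z) / z)"
  proof -
    have "integral {x - R..x - \<epsilon>} g = integral {-R..-\<epsilon>} (\<lambda>z. f (x + z) / z)"
      using integral_shift_real_ivl[of "x - R" x "x - \<epsilon>" g] by (simp add: g_def add.commute)
    also have "\<dots> = integral {\<epsilon>..R} (\<lambda>z. - (f (x - z) / z))"
      using Henstock_Kurzweil_Integration.integral_reflect_real[of R "\<epsilon>" "\<lambda>z. - (f (x - z) / z)"] by simp
    finally show ?thesis by simp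
  qed
  ultimately show ?thesis
    using trunc_Hilbert_split[OF f assms(2)] by (simp add: g_def)
qed

text \<open>One diagonal sequence is enough, since afterwards only inequalities are passed to the
  limit. \<open>trunc_Hilbert\<close> omits the factor \<open>1 / pi\<close>, hence the limit
  \<open>pi * v\<close>.\<close>

lemma trunc_Hilbert_LIMSEQ:
  assumes "has_Hilbert_transform_at f v x" "continuous_on UNIV f"
  shows "(\<lambda>n. trunc_Hilbert f x (1 / real (Suc n)) (real (Suc n))) \<longlonglongrightarrow> pi * v"
proof -
  have 1: "filterlim (\<lambda>n. 1 / real (Suc n)) (at_right 0) sequentially"
    unfolding filterlim_at using LIMSEQ_Suc[OF lim_inverse_n'] by auto
  have 2: "filterlim (\<lambda>n. real (Suc n)) at_top sequentially"
    using filterlim_Suc filterlim_real_sequentially by (rule filterlim_compose[rotated])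
  have "filterlim (\<lambda>n. (1 / real (Suc n), real (Suc n))) (at_right 0 \<times>\<^sub>F at_top) sequentially"
    using 1 2 by (rule filterlim_Pair)
  from filterlim_compose[OF assms(1)[unfolded has_Hilbert_transform_at_def] this]
  have *: "(\<lambda>n. 1 / pi * (LINT y:{y. 1 / real (Suc n) < \<bar>y - x\<bar> \<and> \<bar>y - x\<bar> < real (Suc n)}|lborel. f y / (y - x)))
     \<longlonglongrightarrow> v" by simp
  have "(\<lambda>n. 1 / pi * trunc_Hilbert f x (1 / real (Suc n)) (real (Suc n))) \<longlonglongrightarrow> v"
  proof (rule Lim_transform_eventually[OF *])
    show "\<forall>\<^sub>F n in sequentially. 1 / pi * (LINT y:{y. 1 / real (Suc n) < \<bar>y - x\<bar> \<and> \<bar>y - x\<bar> < real (Suc n)}|lborel. f y / (y - x))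
      = 1 / pi * trunc_Hilbert f x (1 / real (Suc n)) (real (Suc n))"
      \<comment> \<open>At \<open>n = 0\<close> both radii are 1, and the annulus lemma asks for
        \<open>\<epsilon> < R\<close>.\<close>
      using eventually_gt_at_top[of 0]
    proof eventually_elim
      case (elim n)
      then have "1 / real (Suc n) < 1" "1 < real (Suc n)" by simp_all
      then have "1 / real (Suc n) < real (Suc n)" by linarith
      then show ?case using annulus_integral_eq_trunc_Hilbert[OF assms(2)] by simp
    qed
  qed
  from tendsto_mult_left[OF this, of pi] show ?thesis by simp
qed

text \<open>Integration by parts gains the factor \<open>1 / N\<close> without any integrability of
  \<open>f\<close>: the difference of two translates is the derivative of \<open>\<psi>\<close>, an
  integral of \<open>f\<close> over an interval of length \<open>|h|\<close>, so
  \<open>\<psi>\<close> is bounded by \<open>C * |h|\<close>.\<close>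

lemma integral_inverse_shift_diff_le:
  fixes f :: "real \<Rightarrow> real"
  assumes f: "continuous_on UNIV f" and C: "\<And>y. \<bar>f y\<bar> \<le> C" and N: "0 < N" "N \<le> N'"
  shows "integral {N..N'} (\<lambda>z. (f (x + h + z) - f (x + z)) / z) \<le> 2 * C * \<bar>h\<bar> / N"
proof -
  \<comment> \<open>The margin 1 keeps all arguments of \<open>\<Phi>\<close> in the open interval,
    where it has a two-sided derivative.\<close>
  define A B where "A = x - \<bar>h\<bar> + N - 1" and "B = x + \<bar>h\<bar> + N' + 1"
  define \<Phi> where "\<Phi> = (\<lambda>y. integral {A..y} f)"
  define \<psi> where "\<psi> = (\<lambda>z. \<Phi> (x + h + z) - \<Phi> (x + z))"
  have \<Phi>: "(\<Phi> has_real_derivative f y) (at y)" if "A < y" "y < B" for y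
    using integral_has_real_derivative[of A B f y] that continuous_on_subset[OF f]
    unfolding \<Phi>_def by (simp add: at_within_Icc_at)
  have dom: "A < x + z" "x + z < B" "A < x + h + z" "x + h + z < B" if "z \<in> {N..N'}" for z
    using that by (auto simp: A_def B_def)
  have \<psi>: "(\<psi> has_real_derivative (f (x + h + z) - f (x + z))) (at z)" if "z \<in> {N..N'}" for z
    unfolding \<psi>_def using dom[OF that] by (auto intro!: derivative_eq_intros DERIV_chain2[OF \<Phi>])
  have C0: "0 \<le> C" using C[of 0] by linarith
  have \<psi>_le: "\<bar>\<psi> z\<bar> \<le> C * \<bar>h\<bar>" if "z \<in> {N..N'}" for z
  proof -
    have "norm (\<Phi> (x + h + z) - \<Phi> (x + z)) \<le> C * norm ((x + h + z) - (x + z))"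
    proof (rule field_differentiable_bound[of "{A<..<B}" _ f])
      show "(\<Phi> has_field_derivative f y) (at y within {A<..<B})" if "y \<in> {A<..<B}" for y
        using \<Phi>[of y] that by (auto intro: has_field_derivative_at_within)
    qed (use C dom[OF that] in auto)
    then show ?thesis by (simp add: \<psi>_def)
  qed
  \<comment> \<open>Differentiating \<open>\<psi> z / z\<close> leaves the error
    \<open>- \<psi> z / z^2\<close>; the second term of \<open>G\<close> contributes
    \<open>C * |h| / z^2\<close>, which absorbs it, so that the derivative of \<open>G\<close>
    dominates the integrand.\<close>
  define G where "G = (\<lambda>z. \<psi> z / z - C * \<bar>h\<bar> / z)"
  have G: "(G has_real_derivative ((f (x + h + z) - f (x + z)) / z - \<psi> z / z^2 + C * \<bar>h\<bar> / z^2)) (at z)"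
    if "z \<in> {N..N'}" for z
    unfolding G_def using that N
    by (auto intro!: derivative_eq_intros \<psi> simp: field_simps power2_eq_square)
  have "integral {N..N'} (\<lambda>z. (f (x + h + z) - f (x + z)) / z) \<le> G N' - G N"
  proof (rule has_integral_le)
    show "((\<lambda>z. (f (x + h + z) - f (x + z)) / z) has_integral
        integral {N..N'} (\<lambda>z. (f (x + h + z) - f (x + z)) / z)) {N..N'}"
      using N by (intro integrable_integral integrable_continuous_interval)
        (auto intro!: continuous_intros continuous_on_compose2[OF f])
    show "((\<lambda>z. (f (x + h + z) - f (x + z)) / z - \<psi> z / z^2 + C * \<bar>h\<bar> / z^2) has_integral G N' - G N) {N..N'}"
      using G N by (intro fundamental_theorem_of_calculus)
        (auto simp: has_real_derivative_iff_has_vector_derivative[symmetric] intro: has_field_derivative_at_within)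
    show "(f (x + h + z) - f (x + z)) / z \<le> (f (x + h + z) - f (x + z)) / z - \<psi> z / z^2 + C * \<bar>h\<bar> / z^2"
      if "z \<in> {N..N'}" for z
    proof -
      have "\<psi> z / z^2 \<le> C * \<bar>h\<bar> / z^2" using \<psi>_le[OF that] by (intro divide_right_mono) auto
      then show ?thesis by simp
    qed
  qed
  also have "G N' - G N = (\<psi> N' - C * \<bar>h\<bar>) / N' + (C * \<bar>h\<bar> - \<psi> N) / N"
    using N by (simp add: G_def diff_divide_distrib)
  also have "\<dots> \<le> 0 + (C * \<bar>h\<bar> + C * \<bar>h\<bar>) / N"
    using \<psi>_le[of N] \<psi>_le[of N'] N
    by (intro add_mono divide_right_mono) (auto intro: divide_nonpos_pos)
  finally show ?thesis by simp
qed

lemma abs_integral_inverse_shift_diff_le: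
  fixes f :: "real \<Rightarrow> real"
  assumes f: "continuous_on UNIV f" and C: "\<And>y. \<bar>f y\<bar> \<le> C" and N: "0 < N" "N \<le> N'"
  shows "\<bar>integral {N..N'} (\<lambda>z. f (x + z) / z) - integral {N..N'} (\<lambda>z. f (x' + z) / z)\<bar>
    \<le> 2 * C * \<bar>x - x'\<bar> / N"
proof -
  have le: "integral {N..N'} (\<lambda>z. f (p + z) / z) - integral {N..N'} (\<lambda>z. f (q + z) / z)
     \<le> 2 * C * \<bar>p - q\<bar> / N" for p q
  proof -
    have "continuous_on {N..N'} (\<lambda>z. f (p + z) / z)" "continuous_on {N..N'} (\<lambda>z. f (q + z) / z)"
      using N by (auto intro!: continuous_intros continuous_on_compose2[OF f])
    then show ?thesis
      using integral_inverse_shift_diff_le[OF f C N, of q "p - q"]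
      by (simp add: diff_divide_distrib integral_diff integrable_continuous_interval)
  qed
  show ?thesis using le[of x x'] le[of x' x] by (auto simp: abs_minus_commute)
qed

lemma trunc_Hilbert_shift_diff_le:
  fixes f :: "real \<Rightarrow> real"
  assumes f: "continuous_on UNIV f" and C: "\<And>y. \<bar>f y\<bar> \<le> C" and N: "0 < N" "N \<le> N'"
  shows "\<bar>trunc_Hilbert f x N N' - trunc_Hilbert f x' N N'\<bar> \<le> 4 * C * \<bar>x - x'\<bar> / N"
proof -
  have "continuous_on UNIV (\<lambda>y. f (- y))"
    by (auto intro!: continuous_intros continuous_on_compose2[OF f])
  from abs_integral_inverse_shift_diff_le[OF this C N, of "-x" "-x'"]
  have "\<bar>integral {N..N'} (\<lambda>z. f (x - z) / z) - integral {N..N'} (\<lambda>z. f (x' - z) / z)\<bar>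
    \<le> 2 * C * \<bar>x - x'\<bar> / N"
    by (simp add: abs_minus_commute)
  with abs_integral_inverse_shift_diff_le[OF f C N, of x x'] show ?thesis
    unfolding trunc_Hilbert_split[OF f N(1)] by linarith
qed

section \<open>Differences of Hilbert transforms against truncated differences\<close>

lemma trunc_Hilbert_integrable:
  fixes f :: "real \<Rightarrow> real"
  assumes "continuous_on UNIV f" "0 < a"
  shows "(\<lambda>z. (f (x + z) - f (x - z)) / z) integrable_on {a..b}"
  using assms by (intro integrable_continuous_interval)
    (auto intro!: continuous_intros continuous_on_compose2[OF assms(1)])

lemma trunc_Hilbert_combine:
  fixes f :: "real \<Rightarrow> real"
  assumes "continuous_on UNIV f" "0 < a" "a \<le> b" "b \<le> c"
  shows "trunc_Hilbert f x a c = trunc_Hilbert f x a b + trunc_Hilbert f x b c"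
  unfolding trunc_Hilbert_def using assms
  by (intro Henstock_Kurzweil_Integration.integral_combine[symmetric] trunc_Hilbert_integrable) auto

text \<open>This is the cancellation for which \<open>trunc_Hilbert\<close> pairs
  \<open>x + z\<close> with \<open>x - z\<close>: the odd kernel sees only a symmetric difference,
  which a Lipschitz function makes of order \<open>z\<close>.\<close>

lemma Lipschitz_symmetric_quotient_le:
  fixes f :: "real \<Rightarrow> real"
  assumes L: "\<And>y y'. \<bar>f y - f y'\<bar> \<le> C * \<bar>y - y'\<bar>" and "0 < z"
  shows "\<bar>(f (x + z) - f (x - z)) / z\<bar> \<le> 2 * C"
  using L[of "x + z" "x - z"] assms(2) by (simp add: field_simps abs_mult)

lemma trunc_Hilbert_near_le:
  fixes f :: "real \<Rightarrow> real"
  assumes f: "continuous_on UNIV f" and L: "\<And>y y'. \<bar>f y - f y'\<bar> \<le> C * \<bar>y - y'\<bar>" and "0 < a" "a \<le> b"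
  shows "\<bar>trunc_Hilbert f x a b\<bar> \<le> 2 * C * (b - a)"
proof -
  have "norm (trunc_Hilbert f x a b) \<le> 2 * C * measure lborel (cbox a b)"
    unfolding trunc_Hilbert_def
  proof (rule has_integral_bound)
    show "0 \<le> 2 * C" using L[of 1 0] by simp
    show "((\<lambda>z. (f (x + z) - f (x - z)) / z) has_integral
        integral {a..b} (\<lambda>z. (f (x + z) - f (x - z)) / z)) (cbox a b)"
      using trunc_Hilbert_integrable[OF f assms(3)] by (simp add: integrable_integral)
    show "norm ((f (x + z) - f (x - z)) / z) \<le> 2 * C" if "z \<in> cbox a b" for z
      using Lipschitz_symmetric_quotient_le[OF L, of z x] that assms(3) by simp
  qed
  then show ?thesis using assms(4) by simp
qed

text \<open>A single transform has no rate of convergence, but a difference does. The part inside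
  \<open>\<epsilon>\<close> costs \<open>2 * C * \<epsilon>\<close> at each of the two points by the
  Lipschitz bound, and the parts beyond \<open>R\<close> nearly cancel by the shift estimate. The
  error depends on \<open>f\<close> only through \<open>C\<close>, which later gives uniformity in
  time.\<close>

lemma Hilbert_diff_trunc_le:
  fixes f :: "real \<Rightarrow> real"
  assumes f: "continuous_on UNIV f" and C: "\<And>y. \<bar>f y\<bar> \<le> C"
    and L: "\<And>y y'. \<bar>f y - f y'\<bar> \<le> C * \<bar>y - y'\<bar>"
    and v: "has_Hilbert_transform_at f v x" "has_Hilbert_transform_at f v' x'"
    and e: "0 < \<epsilon>" "\<epsilon> \<le> R"
  shows "\<bar>pi * (v - v') - (trunc_Hilbert f x \<epsilon> R - trunc_Hilbert f x' \<epsilon> R)\<bar>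
    \<le> 4 * C * \<epsilon> + 4 * C * \<bar>x - x'\<bar> / R"
proof (rule Lim_bounded)
  let ?S = "\<lambda>n x. trunc_Hilbert f x (1 / real (Suc n)) (real (Suc n))"
  show "(\<lambda>n. \<bar>(?S n x - ?S n x') - (trunc_Hilbert f x \<epsilon> R - trunc_Hilbert f x' \<epsilon> R)\<bar>)
    \<longlonglongrightarrow> \<bar>pi * (v - v') - (trunc_Hilbert f x \<epsilon> R - trunc_Hilbert f x' \<epsilon> R)\<bar>"
    using tendsto_diff[OF trunc_Hilbert_LIMSEQ[OF v(1) f] trunc_Hilbert_LIMSEQ[OF v(2) f]]
    by (intro tendsto_intros) (simp add: right_diff_distrib)
  define M where "M = nat \<lceil>max R (1 / \<epsilon>)\<rceil>"
  show "\<forall>n\<ge>M. \<bar>(?S n x - ?S n x') - (trunc_Hilbert f x \<epsilon> R - trunc_Hilbert f x' \<epsilon> R)\<bar>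
    \<le> 4 * C * \<epsilon> + 4 * C * \<bar>x - x'\<bar> / R"
  proof (intro allI impI)
    fix n assume "M \<le> n"
    then have "max R (1 / \<epsilon>) \<le> real (Suc n)" unfolding M_def by linarith
    then have n: "R \<le> real (Suc n)" "1 / real (Suc n) \<le> \<epsilon>"
      using e by (auto simp: field_simps)
    define a b where "a = 1 / real (Suc n)" and "b = real (Suc n)"
    have ab: "0 < a" "a \<le> \<epsilon>" "R \<le> b" using n by (auto simp: a_def b_def)
    have C0: "0 \<le> C" using C[of 0] by linarith
    have split: "trunc_Hilbert f y a b = trunc_Hilbert f y a \<epsilon> + trunc_Hilbert f y \<epsilon> R + trunc_Hilbert f y R b" for y
      using trunc_Hilbert_combine[OF f, of a \<epsilon> b y] trunc_Hilbert_combine[OF f, of \<epsilon> R b y] ab e by simp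
    have "\<bar>trunc_Hilbert f y a \<epsilon>\<bar> \<le> 2 * C * \<epsilon>" for y
    proof -
      have "\<bar>trunc_Hilbert f y a \<epsilon>\<bar> \<le> 2 * C * (\<epsilon> - a)"
        using trunc_Hilbert_near_le[OF f L, of a \<epsilon> y] ab by simp
      also have "\<dots> \<le> 2 * C * \<epsilon>" using C0 ab by (intro mult_left_mono) auto
      finally show ?thesis .
    qed
    from this[of x] this[of x'] show "\<bar>(?S n x - ?S n x') - (trunc_Hilbert f x \<epsilon> R - trunc_Hilbert f x' \<epsilon> R)\<bar>
      \<le> 4 * C * \<epsilon> + 4 * C * \<bar>x - x'\<bar> / R"
      using trunc_Hilbert_shift_diff_le[OF f C, of R b x x'] ab e
      unfolding split[unfolded a_def b_def] by (simp add: a_def b_def)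
  qed
qed

lemma Hilbert_diff_le:
  fixes f :: "real \<Rightarrow> real"
  assumes f: "continuous_on UNIV f" and C: "\<And>y. \<bar>f y\<bar> \<le> C"
    and L: "\<And>y y'. \<bar>f y - f y'\<bar> \<le> C * \<bar>y - y'\<bar>"
    and v: "has_Hilbert_transform_at f v x" "has_Hilbert_transform_at f v' x'"
  shows "\<bar>v - v'\<bar> \<le> 2 * C * (1 + \<bar>x - x'\<bar>)"
proof -
  have C0: "0 \<le> C" using C[of 0] by linarith
  \<comment> \<open>With \<open>\<epsilon> = R = 1\<close> the truncated integrals run over a single
    point and vanish, so the error terms alone bound the difference.\<close>
  have "pi * \<bar>v - v'\<bar> \<le> 4 * C * (1 + \<bar>x - x'\<bar>)"
    using Hilbert_diff_trunc_le[OF f C L v, of 1 1]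
    by (simp add: trunc_Hilbert_def abs_mult right_diff_distrib[symmetric] distrib_left)
  moreover have "2 * \<bar>v - v'\<bar> \<le> pi * \<bar>v - v'\<bar>" using pi_ge_two by (intro mult_right_mono) auto
  ultimately show ?thesis by simp
qed

text \<open>The right half of the velocity difference, with \<open>g\<close> the profile minus its
  level and \<open>r - w\<close> the left endpoint. Between the endpoints only the second integral
  is present, and it is nonnegative up to a window around \<open>r\<close>. Beyond \<open>r\<close>
  the kernels combine to \<open>w / (z * (w + z)) > 0\<close> against \<open>g \<le> 0\<close>, and
  from \<open>R\<close> on the bound \<open>- m\<close> makes this quantitative.\<close>

lemma integral_inverse_shift_sign:
  fixes g :: "real \<Rightarrow> real"
  assumes g: "continuous_on UNIV g" and L: "\<And>y y'. \<bar>g y - g y'\<bar> \<le> C * \<bar>y - y'\<bar>"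
    and r: "g r = 0" and w: "0 < w"
    and inner: "\<And>y. r - w \<le> y \<Longrightarrow> y \<le> r \<Longrightarrow> 0 \<le> g y"
    and outer: "\<And>y. r \<le> y \<Longrightarrow> g y \<le> 0"
    and far: "\<And>y. R \<le> y \<Longrightarrow> g y \<le> - m" and m: "0 \<le> m"
    and e: "0 < \<epsilon>" "2 * \<epsilon> \<le> w" "\<epsilon> \<le> R - r" and N: "R - r + w \<le> N"
  shows "integral {\<epsilon>..N} (\<lambda>z. g (r + z) / z) - integral {\<epsilon>..N} (\<lambda>z. g (r - w + z) / z)
    \<le> 2 * C * \<epsilon> - m * w * (1 / (R - (r - w)) - 1 / N)"
proof -
  have C0: "0 \<le> C" using L[of 1 0] by simp
  have int: "(\<lambda>z. g (p + z) / z) integrable_on {a..b}" if "0 < a" for p a b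
    using that by (intro integrable_continuous_interval)
      (auto intro!: continuous_intros continuous_on_compose2[OF g])
  have int2: "(\<lambda>z. g (r + z) / (w + z)) integrable_on {a..b}" if "0 < a" for a b
    using that w by (intro integrable_continuous_interval)
      (auto intro!: continuous_intros continuous_on_compose2[OF g])
  let ?l = "\<lambda>z. g (r - w + z) / z"
  have 1: "integral {\<epsilon>..N} (\<lambda>z. g (r + z) / z) \<le> integral {\<epsilon>..N - w} (\<lambda>z. g (r + z) / z)"
  proof -
    have "integral {\<epsilon>..N - w} (\<lambda>z. g (r + z) / z) + integral {N - w..N} (\<lambda>z. g (r + z) / z)
        = integral {\<epsilon>..N} (\<lambda>z. g (r + z) / z)"
      using e N w by (intro Henstock_Kurzweil_Integration.integral_combine int) auto
    moreover have "integral {N - w..N} (\<lambda>z. g (r + z) / z) \<le> integral {N - w..N} (\<lambda>z. 0)"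
      using e N w outer by (intro integral_le int) (auto intro!: divide_nonpos_pos)
    ultimately show ?thesis by simp
  qed
  have 2: "0 \<le> integral {\<epsilon>..w - \<epsilon>} ?l"
    using e w inner by (intro integral_nonneg int) (auto intro!: divide_nonneg_pos)
  \<comment> \<open>Near \<open>z = w\<close> the second integral passes the zero of
    \<open>g\<close> at \<open>r\<close>. There \<open>|g| \<le> C * |z - w| \<le> C * z\<close>, so
    the integrand is at most \<open>C\<close> on a window of length \<open>2 * \<epsilon>\<close>.
    Cutting out this window makes the remaining range match that of the first integral.\<close>
  have 3: "- (2 * C * \<epsilon>) \<le> integral {w - \<epsilon>..w + \<epsilon>} ?l"
  proof -
    have "norm (integral {w - \<epsilon>..w + \<epsilon>} ?l) \<le> C * measure lborel (cbox (w - \<epsilon>) (w + \<epsilon>))"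
    proof (rule has_integral_bound)
      show "(?l has_integral integral {w - \<epsilon>..w + \<epsilon>} ?l) (cbox (w - \<epsilon>) (w + \<epsilon>))"
        using int[of "w - \<epsilon>"] e w by (simp add: integrable_integral)
      show "norm (?l z) \<le> C" if z: "z \<in> cbox (w - \<epsilon>) (w + \<epsilon>)" for z
      proof -
        have zp: "0 < z" "\<epsilon> \<le> z" using z e by auto
        have "\<bar>g (r - w + z)\<bar> \<le> C * \<bar>z - w\<bar>" using L[of "r - w + z" r] r by simp
        also have "\<dots> \<le> C * z" using z zp e by (intro mult_left_mono C0) auto
        finally show ?thesis using zp by (simp add: divide_le_eq)
      qed
    qed (rule C0)
    then show ?thesis using e by auto
  qed
  have 4: "integral {w + \<epsilon>..N} ?l = integral {\<epsilon>..N - w} (\<lambda>z. g (r + z) / (w + z))"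
    using integral_shift_real_ivl[of "w + \<epsilon>" w N ?l] by (simp add: add.commute add.left_commute)
  have 5: "integral {\<epsilon>..N} ?l
    = integral {\<epsilon>..w - \<epsilon>} ?l + integral {w - \<epsilon>..w + \<epsilon>} ?l + integral {w + \<epsilon>..N} ?l"
  proof -
    have "integral {\<epsilon>..w - \<epsilon>} ?l + integral {w - \<epsilon>..N} ?l = integral {\<epsilon>..N} ?l"
      using e N w by (intro Henstock_Kurzweil_Integration.integral_combine int) auto
    moreover have "integral {w - \<epsilon>..w + \<epsilon>} ?l + integral {w + \<epsilon>..N} ?l = integral {w - \<epsilon>..N} ?l"
      using e N w by (intro Henstock_Kurzweil_Integration.integral_combine int) auto
    ultimately show ?thesis by simp
  qed
  define k where "k = (\<lambda>z. g (r + z) / z - g (r + z) / (w + z))"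
  have k_eq: "k z = g (r + z) * (w / (z * (w + z)))" if "0 < z" for z
    using that w by (simp add: k_def field_simps)
  have kint: "k integrable_on {a..b}" if "0 < a" for a b
    unfolding k_def using that by (intro integrable_diff int int2)
  have 6: "integral {\<epsilon>..N - w} (\<lambda>z. g (r + z) / z) - integral {\<epsilon>..N - w} (\<lambda>z. g (r + z) / (w + z))
    = integral {\<epsilon>..N - w} k"
    unfolding k_def using e by (intro integral_diff[symmetric] int int2) auto
  have 7: "integral {\<epsilon>..N - w} k = integral {\<epsilon>..R - r} k + integral {R - r..N - w} k"
    using e N w by (intro Henstock_Kurzweil_Integration.integral_combine[symmetric] kint) auto
  have 8: "integral {\<epsilon>..R - r} k \<le> integral {\<epsilon>..R - r} (\<lambda>z. 0)"
  proof (rule integral_le)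
    show "k z \<le> 0" if "z \<in> {\<epsilon>..R - r}" for z
    proof -
      have "0 < z" using that e by auto
      then show ?thesis
        unfolding k_eq[OF \<open>0 < z\<close>] using w outer[of "r + z"] by (intro mult_nonpos_nonneg) auto
    qed
  qed (use e kint in auto)
  \<comment> \<open>Weakening the kernel from \<open>w / (z * (w + z))\<close> to
    \<open>w / (w + z)^2\<close> gives an elementary antiderivative and, in the limit, the factor
    \<open>1 / (R - l)\<close> with \<open>l = r - w\<close>.\<close>
  have 9: "integral {R - r..N - w} k \<le> m * w / (w + (N - w)) - m * w / (w + (R - r))"
  proof (rule has_integral_le)
    show "(k has_integral integral {R - r..N - w} k) {R - r..N - w}"
      using e by (intro integrable_integral kint) auto
    show "((\<lambda>z. - (m * w / (w + z)^2)) has_integral m * w / (w + (N - w)) - m * w / (w + (R - r))) {R - r..N - w}"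
    proof (rule fundamental_theorem_of_calculus)
      show "R - r \<le> N - w" using N by simp
      show "((\<lambda>z. m * w / (w + z)) has_vector_derivative - (m * w / (w + z)^2)) (at z within {R - r..N - w})"
        if "z \<in> {R - r..N - w}" for z
        unfolding has_real_derivative_iff_has_vector_derivative[symmetric] using that e w
        by (auto intro!: derivative_eq_intros simp: power2_eq_square)
    qed
    show "k z \<le> - (m * w / (w + z)^2)" if z: "z \<in> {R - r..N - w}" for z
    proof -
      have zp: "0 < z" using z e by auto
      have "k z \<le> - m * (w / (z * (w + z)))"
        unfolding k_eq[OF zp] using far[of "r + z"] z zp w by (intro mult_right_mono) auto
      also have "\<dots> \<le> - m * (w / (w + z)^2)"
      proof -
        have "w / (w + z)^2 \<le> w / (z * (w + z))"
          using zp w by (intro divide_left_mono) (auto simp: power2_eq_square intro!: mult_right_mono)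
        from mult_left_mono[OF this m] show ?thesis by simp
      qed
      finally show ?thesis by simp
    qed
  qed
  have "m * w / (w + (N - w)) - m * w / (w + (R - r)) = - m * w * (1 / (R - (r - w)) - 1 / N)"
    by (simp add: algebra_simps)
  with 1 2 3 4 5 6 7 8 9 show ?thesis by simp
qed

text \<open>Both half-lines contribute with the same sign; the quantitative gain is taken from the
  right one, and the left one is estimated by zero. The Lipschitz constant controls only truncation
  errors and disappears in the limit.\<close>

lemma Hilbert_contraction:
  fixes f :: "real \<Rightarrow> real"
  assumes f: "continuous_on UNIV f" and L: "\<And>y y'. \<bar>f y - f y'\<bar> \<le> C * \<bar>y - y'\<bar>"
    and v: "has_Hilbert_transform_at f v r" "has_Hilbert_transform_at f v' l"
    and lr: "l < r" "r < R" and eq: "f l = c" "f r = c"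
    and inner: "\<And>y. l \<le> y \<Longrightarrow> y \<le> r \<Longrightarrow> c \<le> f y"
    and left: "\<And>y. y \<le> l \<Longrightarrow> f y \<le> c" and right: "\<And>y. r \<le> y \<Longrightarrow> f y \<le> c"
    and far: "\<And>y. R \<le> y \<Longrightarrow> f y \<le> b" and bc: "b \<le> c"
  shows "pi * (v - v') \<le> - ((c - b) * (r - l) / (R - l))"
proof -
  let ?e = "\<lambda>n. 1 / real (Suc n)" and ?N = "\<lambda>n. real (Suc n)"
  let ?S = "\<lambda>n x. trunc_Hilbert f x (?e n) (?N n)"
  let ?B = "\<lambda>n. 4 * C * ?e n - (c - b) * (r - l) * (1 / (R - l) - ?e n)"
  have e0: "?e \<longlonglongrightarrow> 0" using LIMSEQ_Suc[OF lim_inverse_n'] by simp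
  have lim: "?B \<longlonglongrightarrow> 4 * C * 0 - (c - b) * (r - l) * (1 / (R - l) - 0)"
    by (intro tendsto_intros e0)
  have lim': "(\<lambda>n. ?S n r - ?S n l) \<longlonglongrightarrow> pi * v - pi * v'"
    by (intro tendsto_diff trunc_Hilbert_LIMSEQ v f)
  \<comment> \<open>The first two thresholds make \<open>1 / real (Suc n)\<close> an admissible
    inner radius; the last two make \<open>real (Suc n)\<close> an admissible outer radius for the
    right half-line and for the reflected left one.\<close>
  define P where "P = max (1 / (R - r)) (max (2 / (r - l)) (max (R - l) (r - l + 1)))"
  have "pi * v - pi * v' \<le> 4 * C * 0 - (c - b) * (r - l) * (1 / (R - l) - 0)"
  proof (rule LIMSEQ_le[OF lim' lim], intro exI allI impI)
    fix n assume "nat \<lceil>P\<rceil> \<le> n"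
    then have "P \<le> ?N n" by linarith
    then have n: "1 / (R - r) \<le> ?N n" "2 / (r - l) \<le> ?N n" "R - l \<le> ?N n" "r - l + 1 \<le> ?N n"
      by (auto simp: P_def)
    then have n': "?e n \<le> R - r" "2 * ?e n \<le> r - l" using lr by (auto simp: field_simps)
    define g where "g = (\<lambda>y. f y - c)"
    define h where "h = (\<lambda>y. g (- y))"
    have g: "continuous_on UNIV g" unfolding g_def by (intro continuous_intros f)
    have h: "continuous_on UNIV h" unfolding h_def
      by (auto intro!: continuous_intros continuous_on_compose2[OF g])
    have gS: "?S n x = trunc_Hilbert g x (?e n) (?N n)" for x
      by (simp add: trunc_Hilbert_def g_def)
    have hs: "\<And>x. integral {?e n..?N n} (\<lambda>z. g (x - z) / z) = integral {?e n..?N n} (\<lambda>z. h (- x + z) / z)"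
      by (simp add: h_def)
    have 1: "integral {?e n..?N n} (\<lambda>z. g (r + z) / z) - integral {?e n..?N n} (\<lambda>z. g (r - (r - l) + z) / z)
      \<le> 2 * C * ?e n - (c - b) * (r - l) * (1 / (R - (r - (r - l))) - 1 / ?N n)"
      by (rule integral_inverse_shift_sign[OF g])
         (use lr n n' bc eq inner right far L in \<open>auto simp: g_def algebra_simps\<close>)
    \<comment> \<open>The left half-line is the same estimate for the reflected profile with
      \<open>m = 0\<close>, so its far point \<open>- l + 1\<close> is an arbitrary choice.\<close>
    have 2: "integral {?e n..?N n} (\<lambda>z. h (- l + z) / z) - integral {?e n..?N n} (\<lambda>z. h (- l - (r - l) + z) / z)
      \<le> 2 * C * ?e n - 0 * (r - l) * (1 / ((- l + 1) - (- l - (r - l))) - 1 / ?N n)"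
    proof (rule integral_inverse_shift_sign[OF h])
      show "\<bar>h y - h y'\<bar> \<le> C * \<bar>y - y'\<bar>" for y y'
        using L[of "-y" "-y'"] by (simp add: h_def g_def abs_minus_commute)
      show "?e n \<le> - l + 1 - - l" by simp
    qed (use lr n n' eq inner left in \<open>auto simp: h_def g_def\<close>)
    show "?S n r - ?S n l \<le> ?B n"
      unfolding gS using 1 2 trunc_Hilbert_split[OF g, of "?e n" _ "?N n"] hs by simp
  qed
  then show ?thesis by (simp add: right_diff_distrib)
qed

lemma trunc_Hilbert_continuous_on:
  fixes \<theta> :: "real \<Rightarrow> real \<Rightarrow> real"
  assumes \<theta>: "continuous_on (S \<times> UNIV) (\<lambda>(t, x). \<theta> t x)" and "0 < \<epsilon>"
  shows "continuous_on (S \<times> UNIV) (\<lambda>(t, x). trunc_Hilbert (\<theta> t) x \<epsilon> R)"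
proof -
  have "continuous_on ((S \<times> UNIV) \<times> cbox \<epsilon> R)
      (\<lambda>((t, x), z). (\<theta> t (x + z) - \<theta> t (x - z)) / z)"
    unfolding split_beta using assms(2)
    by (auto intro!: continuous_intros
      continuous_on_compose2[OF \<theta>, where f="\<lambda>p. (fst (fst p), snd (fst p) + snd p)", unfolded split_beta, simplified]
      continuous_on_compose2[OF \<theta>, where f="\<lambda>p. (fst (fst p), snd (fst p) - snd p)", unfolded split_beta, simplified])
  then have "continuous_on ((S \<times> UNIV) \<times> cbox \<epsilon> R)
      (\<lambda>(p, z). (\<theta> (fst p) (snd p + z) - \<theta> (fst p) (snd p - z)) / z)"
    by (simp add: split_beta)
  from integral_continuous_on_param[OF this] show ?thesis
    by (simp add: trunc_Hilbert_def split_beta)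
qed

subsection \<open>Trajectories of a continuous velocity field\<close>

text \<open>A Gronwall estimate valid in both time directions and through zeros of \<open>D\<close>:
  \<open>ln (1 + D ^ 2)\<close> is a differentiable substitute for a logarithm of the distance, and
  its derivative is at most \<open>4 * K\<close> because
  \<open>a * (1 + a) \<le> 2 * (1 + a ^ 2)\<close>.\<close>

lemma ln_one_plus_square_growth:
  fixes D :: "real \<Rightarrow> real"
  assumes D: "\<And>t. t \<in> {0..T} \<Longrightarrow> (D has_real_derivative D' t) (at t within {0..T})"
    and K: "\<And>t. t \<in> {0..T} \<Longrightarrow> \<bar>D' t\<bar> \<le> K * (1 + \<bar>D t\<bar>)"
    and st: "s \<in> {0..T}" "t \<in> {0..T}"
  shows "\<bar>ln (1 + D t ^ 2) - ln (1 + D s ^ 2)\<bar> \<le> 4 * K * \<bar>t - s\<bar>"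
proof -
  have pos: "0 < 1 + x ^ 2" for x :: real by (simp add: add_pos_nonneg)
  have "0 \<le> K * (1 + \<bar>D s\<bar>)" using K[OF st(1)] by linarith
  then have K0: "0 \<le> K"
    using zero_le_mult_iff[of K "1 + \<bar>D s\<bar>"] abs_ge_zero[of "D s"] by linarith
  have "norm (ln (1 + D t ^ 2) - ln (1 + D s ^ 2)) \<le> (4 * K) * norm (t - s)"
  proof (rule field_differentiable_bound)
    show "((\<lambda>t. ln (1 + D t ^ 2)) has_real_derivative 2 * D t * D' t / (1 + D t ^ 2)) (at t within {0..T})"
      if "t \<in> {0..T}" for t
      using D[OF that] pos[of "D t"] by (auto intro!: derivative_eq_intros)
    show "norm (2 * D t * D' t / (1 + D t ^ 2)) \<le> 4 * K" if "t \<in> {0..T}" for t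
    proof -
      have sq: "a * (1 + a) \<le> 2 * (1 + a ^ 2)" for a :: real
      proof -
        have "0 \<le> (a - 1) ^ 2 + a ^ 2 + 3" by (intro add_nonneg_nonneg) auto
        then show ?thesis by (simp add: power2_eq_square algebra_simps)
      qed
      have "\<bar>D t\<bar> * (1 + \<bar>D t\<bar>) \<le> 2 * (1 + D t ^ 2)"
        using sq[of "\<bar>D t\<bar>"] by simp
      then have 2: "K * (\<bar>D t\<bar> * (1 + \<bar>D t\<bar>)) \<le> K * (2 * (1 + D t ^ 2))" using K0 by (intro mult_left_mono)
      have "\<bar>D t\<bar> * \<bar>D' t\<bar> \<le> \<bar>D t\<bar> * (K * (1 + \<bar>D t\<bar>))" using K[OF that] by (intro mult_left_mono) auto
      also have "\<dots> \<le> K * (2 * (1 + D t ^ 2))" using 2 by (simp add: mult.left_commute)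
      finally have "2 * (\<bar>D t\<bar> * \<bar>D' t\<bar>) \<le> 4 * K * (1 + D t ^ 2)" by (simp add: algebra_simps)
      moreover have "norm (2 * D t * D' t / (1 + D t ^ 2)) = 2 * (\<bar>D t\<bar> * \<bar>D' t\<bar>) / (1 + D t ^ 2)"
        using pos[of "D t"] by (simp add: abs_mult)
      ultimately show ?thesis using pos[of "D t"] by (simp only: divide_le_eq if_True)
    qed
  qed (use st in auto)
  then show ?thesis by simp
qed

text \<open>Because of the delay, the integrand up to time \<open>(k + 1) * \<delta>\<close> reads
  the curve only up to \<open>k * \<delta>\<close>. The Picard iterates are thus stationary on
  growing intervals, and an iterate of sufficiently high index is an exact solution on
  \<open>{0..T}\<close>.\<close>

lemma Tonelli_delay_solution:
  fixes w :: "real \<Rightarrow> real \<Rightarrow> real"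
  assumes w: "continuous_on ({0..T} \<times> UNIV) (\<lambda>(t, x). w t x)" and d: "0 < \<delta>"
  obtains z where "continuous_on {0..T} z"
    "\<And>t. t \<in> {0..T} \<Longrightarrow> z t = x0 + integral {0..t} (\<lambda>s. w s (z (max (s - \<delta>) 0)))"
proof -
  define \<Gamma> where "\<Gamma> = (\<lambda>y t. x0 + integral {0..t} (\<lambda>s. w s (y (max (s - \<delta>) 0))))"
  define y where "y k = (\<Gamma> ^^ k) (\<lambda>_. x0)" for k
  have ySuc: "y (Suc k) = \<Gamma> (y k)" for k by (simp add: y_def)
  have cont: "continuous_on {0..T} (y k)" for k
  proof (induction k)
    case 0
    show ?case by (simp add: y_def)
  next
    case (Suc k)
    have "continuous_on {0..T} (\<lambda>s. w s (y k (max (s - \<delta>) 0)))"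
      by (rule continuous_on_compose2[OF w, where f="\<lambda>s. (s, y k (max (s - \<delta>) 0))", unfolded split_beta, simplified])
        (use d in \<open>auto intro!: continuous_intros continuous_on_compose2[OF Suc]\<close>)
    then show ?case
      unfolding ySuc \<Gamma>_def
      by (intro continuous_intros indefinite_integral_continuous_1 integrable_continuous_interval)
  qed
  have eq: "y (Suc k) t = y k t" if "t \<in> {0..T}" "t \<le> real k * \<delta>" for k t
    using that
  proof (induction k arbitrary: t)
    case 0
    then have "t = 0" by simp
    then show ?case by (simp add: y_def \<Gamma>_def)
  next
    case (Suc k)
    have "y (Suc k) (max (s - \<delta>) 0) = y k (max (s - \<delta>) 0)" if "s \<in> {0..t}" for s
      using that Suc.prems d by (intro Suc.IH) (auto simp: algebra_simps)
    then have "integral {0..t} (\<lambda>s. w s (y (Suc k) (max (s - \<delta>) 0)))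
      = integral {0..t} (\<lambda>s. w s (y k (max (s - \<delta>) 0)))"
      by (intro integral_cong) simp
    then show ?case unfolding ySuc[of "Suc k"] ySuc[of k] \<Gamma>_def[THEN fun_cong, of "y k"]
      by (subst \<Gamma>_def) (simp add: ySuc \<Gamma>_def)
  qed
  obtain k where k: "T < real k * \<delta>" using reals_Archimedean3[OF d] by blast
  have "y k t = x0 + integral {0..t} (\<lambda>s. w s (y k (max (s - \<delta>) 0)))" if "t \<in> {0..T}" for t
  proof -
    have "y k t = y (Suc k) t" using eq[of t k] that k by simp
    then show ?thesis unfolding ySuc by (simp add: \<Gamma>_def)
  qed
  with cont show thesis by (rule that)
qed

text \<open>Existence without uniqueness, since only continuity of the velocity will be at hand. The
  delayed solutions share the Lipschitz constant \<open>B\<close>, so Arzela-Ascoli yields a uniform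
  limit, and dominated convergence passes to the limit in the integral equation.\<close>

lemma Peano_bounded:
  fixes w :: "real \<Rightarrow> real \<Rightarrow> real"
  assumes w: "continuous_on ({0..T} \<times> UNIV) (\<lambda>(t, x). w t x)"
    and B: "\<And>t x. t \<in> {0..T} \<Longrightarrow> \<bar>w t x\<bar> \<le> B" and T: "0 \<le> T"
  obtains X where "X 0 = x0" "\<And>t. t \<in> {0..T} \<Longrightarrow> (X has_real_derivative w t (X t)) (at t within {0..T})"
proof -
  have B0: "0 \<le> B" using B[of 0 0] T by simp
  define d where "d n = 1 / real (Suc n)" for n
  have dpos: "0 < d n" for n by (simp add: d_def)
  have "\<exists>z. continuous_on {0..T} z \<and>
    (\<forall>t\<in>{0..T}. z t = x0 + integral {0..t} (\<lambda>s. w s (z (max (s - d n) 0))))" for n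
    using Tonelli_delay_solution[OF w dpos[of n], of x0] by metis
  then obtain z where z_cont: "\<And>n. continuous_on {0..T} (z n)"
    and z: "\<And>n t. t \<in> {0..T} \<Longrightarrow> z n t = x0 + integral {0..t} (\<lambda>s. w s (z n (max (s - d n) 0)))"
    by metis
  have w_cont: "continuous_on {0..T} (\<lambda>s. w s (y s))" if "continuous_on {0..T} y" for y
    by (rule continuous_on_compose2[OF w, where f="\<lambda>s. (s, y s)", unfolded split_beta, simplified])
      (use that in \<open>auto intro!: continuous_intros\<close>)
  have wz_cont: "continuous_on {0..T} (\<lambda>s. w s (z n (max (s - d n) 0)))" for n
    using less_imp_le[OF dpos[of n]]
    by (intro w_cont) (auto intro!: continuous_intros continuous_on_compose2[OF z_cont])
  have wz_int: "(\<lambda>s. w s (z n (max (s - d n) 0))) integrable_on {a..b}" if "0 \<le> a" "b \<le> T" for n a b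
    using that by (intro integrable_continuous_interval continuous_on_subset[OF wz_cont]) auto
  have le: "\<bar>z n t - z n s\<bar> \<le> B * (t - s)" if "0 \<le> s" "s \<le> t" "t \<le> T" for n s t
  proof -
    have "integral {0..s} (\<lambda>s. w s (z n (max (s - d n) 0))) + integral {s..t} (\<lambda>s. w s (z n (max (s - d n) 0)))
      = integral {0..t} (\<lambda>s. w s (z n (max (s - d n) 0)))"
      using that by (intro Henstock_Kurzweil_Integration.integral_combine wz_int) auto
    then have "z n t - z n s = integral {s..t} (\<lambda>s. w s (z n (max (s - d n) 0)))"
      using z[of t n] z[of s n] that by simp
    moreover have "norm (integral {s..t} (\<lambda>s. w s (z n (max (s - d n) 0)))) \<le> B * measure lborel (cbox s t)"
      using B that B0 wz_int[of s t n]
      by (intro has_integral_bound[OF B0]) (auto simp: integrable_integral)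
    ultimately show ?thesis using that by simp
  qed
  have Lip: "\<bar>z n t - z n s\<bar> \<le> B * \<bar>t - s\<bar>" if "s \<in> {0..T}" "t \<in> {0..T}" for n s t
    using le[of s t n] le[of t s n] that by (cases "s \<le> t") (auto simp: abs_minus_commute)
  obtain g k where g: "continuous_on {0..T} g" "strict_mono (k :: nat \<Rightarrow> nat)"
    and conv: "\<And>e. 0 < e \<Longrightarrow> \<exists>N. \<forall>n x. n \<ge> N \<and> x \<in> {0..T} \<longrightarrow> norm (z (k n) x - g x) < e"
  proof (rule Arzela_Ascoli[of "{0..T}" z "\<bar>x0\<bar> + B * T"])
    show "norm (z n t) \<le> \<bar>x0\<bar> + B * T" if "t \<in> {0..T}" for n t
    proof -
      have "z n 0 = x0" using z[of 0 n] T by simp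
      moreover have "B * t \<le> B * T" using that B0 by (intro mult_left_mono) auto
      ultimately show ?thesis using Lip[of 0 t n] that by simp
    qed
    show "\<exists>d>0. \<forall>n y. y \<in> {0..T} \<and> norm (t - y) < d \<longrightarrow> norm (z n t - z n y) < e"
      if "t \<in> {0..T}" "0 < e" for t e :: real
    proof (intro exI[of _ "e / (B + 1)"] conjI allI impI)
      fix n y assume y: "y \<in> {0..T} \<and> norm (t - y) < e / (B + 1)"
      have "\<bar>z n t - z n y\<bar> \<le> B * \<bar>t - y\<bar>" using Lip that y by blast
      also have "\<dots> \<le> (B + 1) * \<bar>t - y\<bar>" by (intro mult_right_mono) auto
      also have "\<dots> < e" using y B0 by (simp add: field_simps)
      finally show "norm (z n t - z n y) < e" by simp
    qed (use that B0 in auto)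
  qed auto
  have lim: "(\<lambda>n. z (k n) t) \<longlonglongrightarrow> g t" if "t \<in> {0..T}" for t
    unfolding LIMSEQ_iff using conv that by blast
  \<comment> \<open>The common Lipschitz constant makes the vanishing delay cost at most
    \<open>B * d (k n)\<close>.\<close>
  have lim_delay: "(\<lambda>n. z (k n) (max (t - d (k n)) 0)) \<longlonglongrightarrow> g t" if t: "t \<in> {0..T}" for t
  proof -
    have "(\<lambda>n. d (k n)) \<longlonglongrightarrow> 0"
      using LIMSEQ_subseq_LIMSEQ[OF LIMSEQ_Suc[OF lim_inverse_n'] g(2)] by (simp add: d_def o_def)
    then have 0: "(\<lambda>n. B * d (k n)) \<longlonglongrightarrow> 0" by (auto intro: tendsto_mult_right_zero)
    have "norm (z (k n) (max (t - d (k n)) 0) - z (k n) t) \<le> B * d (k n)" for n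
    proof -
      have "\<bar>z (k n) (max (t - d (k n)) 0) - z (k n) t\<bar> \<le> B * \<bar>max (t - d (k n)) 0 - t\<bar>"
        using t dpos[of "k n"] by (intro Lip) auto
      also have "\<dots> \<le> B * d (k n)" using t dpos[of "k n"] B0 by (intro mult_left_mono) auto
      finally show ?thesis by simp
    qed
    then have "(\<lambda>n. z (k n) (max (t - d (k n)) 0) - z (k n) t) \<longlonglongrightarrow> 0"
      by (intro Lim_null_comparison[OF _ 0]) auto
    from tendsto_add[OF this lim[OF t]] show ?thesis by simp
  qed
  have g_eq: "g t = x0 + integral {0..t} (\<lambda>s. w s (g s))" if t: "t \<in> {0..T}" for t
  proof -
    have "(\<lambda>n. integral {0..t} (\<lambda>s. w s (z (k n) (max (s - d (k n)) 0)))) \<longlonglongrightarrow> integral {0..t} (\<lambda>s. w s (g s))"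
    proof (rule dominated_convergence(2)[where h="\<lambda>_. B"])
      show "(\<lambda>n. w s (z (k n) (max (s - d (k n)) 0))) \<longlonglongrightarrow> w s (g s)" if "s \<in> {0..t}" for s
      proof -
        have s: "s \<in> {0..T}" using that t by auto
        have "continuous_on UNIV (w s)"
          by (rule continuous_on_compose2[OF w, where f="\<lambda>x. (s, x)", unfolded split_beta, simplified])
            (use s in \<open>auto intro!: continuous_intros\<close>)
        then show ?thesis using lim_delay[OF s]
          by (metis UNIV_I continuous_on_eq_continuous_at isCont_tendsto_compose open_UNIV)
      qed
    qed (use t B wz_int in auto)
    then have "(\<lambda>n. z (k n) t) \<longlonglongrightarrow> x0 + integral {0..t} (\<lambda>s. w s (g s))"
      unfolding z[OF t] by (intro tendsto_intros)
    with lim[OF t] show ?thesis by (rule LIMSEQ_unique)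
  qed
  show thesis
  proof (rule that[of g])
    show "g 0 = x0" using g_eq[of 0] T by simp
    show "(g has_real_derivative w t (g t)) (at t within {0..T})" if t: "t \<in> {0..T}" for t
      unfolding has_field_derivative_def
    proof (rule has_derivative_transform[OF t])
      show "((\<lambda>t. x0 + integral {0..t} (\<lambda>s. w s (g s))) has_derivative (*) (w t (g t))) (at t within {0..T})"
        unfolding has_field_derivative_def[symmetric]
        using integral_has_real_derivative[OF w_cont[OF g(1)] t]
        by (auto intro!: derivative_eq_intros)
    qed (use g_eq in auto)
  qed
qed

lemma Peano_linear_growth:
  fixes v :: "real \<Rightarrow> real \<Rightarrow> real"
  assumes v: "continuous_on ({0..T} \<times> UNIV) (\<lambda>(t, x). v t x)"
    and K: "\<And>t x. t \<in> {0..T} \<Longrightarrow> \<bar>v t x\<bar> \<le> K * (1 + \<bar>x\<bar>)" and T: "0 \<le> T"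
  obtains X where "X 0 = x0" "\<And>t. t \<in> {0..T} \<Longrightarrow> (X has_real_derivative v t (X t)) (at t within {0..T})"
proof -
  have K0: "0 \<le> K" using K[of 0 0] T by simp
  \<comment> \<open>The a priori bound from \<open>ln_one_plus_square_growth\<close>. The field
    clamped to \<open>{- N..N}\<close> obeys the same linear growth, so its solution never leaves
    the region where clamping has no effect.\<close>
  define N where "N = sqrt ((1 + x0 ^ 2) * exp (4 * K * T))"
  have N0: "0 \<le> N" by (simp add: N_def)
  define w where "w = (\<lambda>t x. v t (max (- N) (min N x)))"
  have w: "continuous_on ({0..T} \<times> UNIV) (\<lambda>(t, x). w t x)"
    unfolding w_def split_beta
    by (rule continuous_on_compose2[OF v, where f="\<lambda>p. (fst p, max (- N) (min N (snd p)))", unfolded split_beta, simplified])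
      (auto intro!: continuous_intros)
  have wK: "\<bar>w t x\<bar> \<le> K * (1 + \<bar>x\<bar>)" "\<bar>w t x\<bar> \<le> K * (1 + N)" if "t \<in> {0..T}" for t x
  proof -
    have *: "\<bar>w t x\<bar> \<le> K * (1 + \<bar>max (- N) (min N x)\<bar>)" unfolding w_def using K[OF that] .
    also have "\<dots> \<le> K * (1 + \<bar>x\<bar>)" using K0 N0 by (intro mult_left_mono) auto
    finally show "\<bar>w t x\<bar> \<le> K * (1 + \<bar>x\<bar>)" .
    note *
    also have "K * (1 + \<bar>max (- N) (min N x)\<bar>) \<le> K * (1 + N)" using K0 N0 by (intro mult_left_mono) auto
    finally show "\<bar>w t x\<bar> \<le> K * (1 + N)" .
  qed
  obtain X where X: "X 0 = x0" "\<And>t. t \<in> {0..T} \<Longrightarrow> (X has_real_derivative w t (X t)) (at t within {0..T})"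
    using Peano_bounded[OF w wK(2) T] by blast
  have "\<bar>X t\<bar> \<le> N" if t: "t \<in> {0..T}" for t
  proof -
    have "\<bar>ln (1 + X t ^ 2) - ln (1 + X 0 ^ 2)\<bar> \<le> 4 * K * \<bar>t - 0\<bar>"
      by (rule ln_one_plus_square_growth[OF X(2) wK(1)]) (use t in auto)
    moreover have "4 * K * \<bar>t - 0\<bar> \<le> 4 * K * T" using t K0 by (intro mult_left_mono) auto
    ultimately have "ln (1 + X t ^ 2) \<le> ln (1 + x0 ^ 2) + 4 * K * T" using X(1) by simp
    then have "exp (ln (1 + X t ^ 2)) \<le> exp (ln (1 + x0 ^ 2) + 4 * K * T)" by simp
    then have "1 + X t ^ 2 \<le> (1 + x0 ^ 2) * exp (4 * K * T)"
      by (simp add: exp_add add_pos_nonneg)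
    then show ?thesis unfolding N_def by (intro real_le_rsqrt) simp
  qed
  then have "max (- N) (min N (X t)) = X t" if "t \<in> {0..T}" for t
    using that[THEN \<open>\<And>t. t \<in> {0..T} \<Longrightarrow> \<bar>X t\<bar> \<le> N\<close>] by (simp add: abs_le_iff min_def max_def)
  then have "w t (X t) = v t (X t)" if "t \<in> {0..T}" for t
    using that by (simp add: w_def)
  with X show thesis by (intro that[of X]) auto
qed

lemma constant_along_curve:
  fixes \<theta> \<theta>\<^sub>t \<theta>\<^sub>x :: "real \<Rightarrow> real \<Rightarrow> real"
  assumes \<theta>x_cont: "continuous_on ({0..T} \<times> UNIV) (\<lambda>(t, x). \<theta>\<^sub>x t x)"
    and t_deriv: "\<And>t x. t \<in> {0..T} \<Longrightarrow> ((\<lambda>s. \<theta> s x) has_real_derivative \<theta>\<^sub>t t x) (at t within {0..T})"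
    and x_deriv: "\<And>t x. t \<in> {0..T} \<Longrightarrow> (\<theta> t has_real_derivative \<theta>\<^sub>x t x) (at x)"
    and X: "\<And>t. t \<in> {0..T} \<Longrightarrow> (X has_real_derivative V t) (at t within {0..T})"
    and eq: "\<And>t. t \<in> {0..T} \<Longrightarrow> \<theta>\<^sub>t t (X t) + V t * \<theta>\<^sub>x t (X t) = 0"
    and st: "s \<in> {0..T}" "t \<in> {0..T}"
  shows "\<theta> t (X t) = \<theta> s (X s)"
proof -
  have "((\<lambda>t. \<theta> t (X t)) has_real_derivative 0) (at t within {0..T})" if t: "t \<in> {0..T}" for t
  proof -
    \<comment> \<open>Joint differentiability comes from the two partial derivatives together with
      joint continuity of the one in \<open>x\<close>.\<close>
    have "((\<lambda>(t, x). \<theta> t x) has_derivative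
        (\<lambda>(dt, dx). \<theta>\<^sub>t t (X t) * dt + blinfun_mult_right (\<theta>\<^sub>x t (X t)) dx)) (at (t, X t) within {0..T} \<times> UNIV)"
    proof (rule has_derivative_partialsI)
      show "((\<lambda>s. \<theta> s (X t)) has_derivative (*) (\<theta>\<^sub>t t (X t))) (at t within {0..T})"
        using t_deriv[OF t] by (simp add: has_field_derivative_def)
      show "(\<theta> s has_derivative blinfun_apply (blinfun_mult_right (\<theta>\<^sub>x s x))) (at x within UNIV)"
        if "s \<in> {0..T}" for s x
        using x_deriv[OF that, of x] by (simp add: has_field_derivative_def)
      have "continuous_on ({0..T} \<times> UNIV) (\<lambda>p. blinfun_mult_right (case p of (t, x) \<Rightarrow> \<theta>\<^sub>x t x))"
        using \<theta>x_cont by (intro bounded_linear.continuous_on[OF bounded_linear_blinfun_mult_right])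
      then show "continuous (at (t, X t) within {0..T} \<times> UNIV) (\<lambda>(s, x). blinfun_mult_right (\<theta>\<^sub>x s x))"
        using t unfolding split_beta continuous_on_eq_continuous_within by simp
    qed auto
    moreover have "((\<lambda>t. (t, X t)) has_derivative (\<lambda>h. (h, V t * h))) (at t within {0..T})"
      using X[OF t] by (auto intro!: derivative_eq_intros simp: has_field_derivative_def)
    ultimately have "((\<lambda>t. \<theta> t (X t)) has_derivative (\<lambda>h. \<theta>\<^sub>t t (X t) * h + \<theta>\<^sub>x t (X t) * (V t * h))) (at t within {0..T})"
      using has_derivative_in_compose[of "\<lambda>t. (t, X t)" _ t "{0..T}" "\<lambda>(t, x). \<theta> t x", OF _ has_derivative_subset]
      by fastforce
    moreover have "\<theta>\<^sub>t t (X t) * h + \<theta>\<^sub>x t (X t) * (V t * h) = 0 * h" for h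
    proof -
      have "\<theta>\<^sub>t t (X t) * h + \<theta>\<^sub>x t (X t) * (V t * h) = (\<theta>\<^sub>t t (X t) + V t * \<theta>\<^sub>x t (X t)) * h" by algebra
      then show ?thesis using eq[OF t] by simp
    qed
    ultimately show ?thesis unfolding has_field_derivative_def by (simp only:)
  qed
  then have "\<exists>c. \<forall>t\<in>{0..T}. \<theta> t (X t) = c"
    by (intro has_field_derivative_zero_constant) auto
  then show ?thesis using st by metis
qed

subsection \<open>The transport equation on a bounded time interval\<close>

text \<open>Substituting \<open>y = z / L\<close> and \<open>y = L * z\<close> makes the two
  integrals cancel except at the ends. Each end is an integral of \<open>f y / y\<close> over an
  interval of logarithmic length \<open>2 * ln L\<close>, so the bound depends on neither
  \<open>a\<close> nor \<open>b\<close> and asks for no integrability of \<open>f\<close>.\<close>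

lemma abs_Frullani_integral_le:
  fixes f :: "real \<Rightarrow> real"
  assumes f: "continuous_on UNIV f" and C: "\<And>y. \<bar>f y\<bar> \<le> C"
    and L: "1 \<le> L" and ab: "0 < a" "a \<le> b"
  shows "\<bar>integral {a..b} (\<lambda>z. (f (z / L) - f (L * z)) / z)\<bar> \<le> 4 * C * ln L"
proof -
  define p q where "p = a / (2 * L)" and "q = 2 * L * b"
  define \<Phi> where "\<Phi> = (\<lambda>y. integral {p..y} (\<lambda>y. f y / y))"
  have p0: "0 < p" using L ab by (simp add: p_def)
  have "continuous_on {p..q} (\<lambda>y. f y / y)"
    using p0 by (auto intro!: continuous_intros continuous_on_subset[OF f])
  then have \<Phi>: "(\<Phi> has_real_derivative f y / y) (at y)" if "p < y" "y < q" for y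
    using integral_has_real_derivative[of p q "\<lambda>y. f y / y" y] that
    unfolding \<Phi>_def by (simp add: at_within_Icc_at)
  define \<Psi> where "\<Psi> = (\<lambda>z. \<Phi> (L * z) - \<Phi> (z / L))"
  have dom: "p < z / L" "z / L \<le> L * z" "L * z < q" if "z \<in> {a..b}" for z
  proof -
    have z: "0 < z" "a \<le> z" "z \<le> b" using that ab by auto
    have "a / (2 * L) < z / L" using z L ab by (simp add: field_simps)
    then show "p < z / L" by (simp add: p_def)
    have "1 * z \<le> (L * L) * z" using L z by (intro mult_right_mono) (auto simp: mult_ge1_I)
    then show "z / L \<le> L * z" using L by (simp add: field_simps)
    have "L * z \<le> L * b" using z L by simp
    moreover have "0 < L * b" using L ab by simp
    ultimately show "L * z < q" by (simp add: q_def)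
  qed
  have \<Psi>: "(\<Psi> has_real_derivative - ((f (z / L) - f (L * z)) / z)) (at z)" if z: "z \<in> {a..b}" for z
  proof -
    have z0: "0 < z" using z ab by auto
    have "((\<lambda>z. \<Phi> (L * z)) has_real_derivative f (L * z) / (L * z) * L) (at z)"
      using dom[OF z] by (intro DERIV_chain2[OF \<Phi>]) (auto intro!: derivative_eq_intros)
    moreover have "((\<lambda>z. \<Phi> (z / L)) has_real_derivative f (z / L) / (z / L) * (1 / L)) (at z)"
      using dom[OF z] L by (intro DERIV_chain2[OF \<Phi>]) (auto intro!: derivative_eq_intros)
    ultimately have "(\<Psi> has_real_derivative
        f (L * z) / (L * z) * L - f (z / L) / (z / L) * (1 / L)) (at z)"
      unfolding \<Psi>_def by (rule DERIV_diff)
    then show ?thesis using z0 L by (simp add: diff_divide_distrib)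
  qed
  have \<Psi>_le: "\<bar>\<Psi> z\<bar> \<le> 2 * C * ln L" if z: "z \<in> {a..b}" for z
  proof -
    have z0: "0 < z" using z ab by auto
    have bound: "f y / y \<le> C / y" "- C / y \<le> f y / y" if "0 < y" for y
      using C[of y] that divide_right_mono[of "- C" "f y" y] by (auto intro: divide_right_mono)
    have y: "p < y" "y < q" "0 < y" if "z / L \<le> y" "y \<le> L * z" for y
      using dom[OF z] that p0 by auto
    \<comment> \<open>Monotonicity of \<open>C * ln y - \<Phi> y\<close> and of
      \<open>C * ln y + \<Phi> y\<close> bounds the increment of \<open>\<Phi>\<close> by
      \<open>C\<close> times the logarithmic length.\<close>
    have "C * ln (z / L) - \<Phi> (z / L) \<le> C * ln (L * z) - \<Phi> (L * z)"
    proof (rule DERIV_nonneg_imp_nondecreasing[OF dom(2)[OF z]])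
      fix y assume "z / L \<le> y" "y \<le> L * z"
      from y[OF this] bound[of y]
      show "\<exists>d. ((\<lambda>y. C * ln y - \<Phi> y) has_real_derivative d) (at y) \<and> 0 \<le> d"
        by (intro exI[of _ "C / y - f y / y"]) (auto intro!: derivative_eq_intros \<Phi>)
    qed
    moreover have "C * ln (z / L) + \<Phi> (z / L) \<le> C * ln (L * z) + \<Phi> (L * z)"
    proof (rule DERIV_nonneg_imp_nondecreasing[OF dom(2)[OF z]])
      fix y assume "z / L \<le> y" "y \<le> L * z"
      from y[OF this] bound[of y]
      show "\<exists>d. ((\<lambda>y. C * ln y + \<Phi> y) has_real_derivative d) (at y) \<and> 0 \<le> d"
        by (intro exI[of _ "C / y + f y / y"]) (auto intro!: derivative_eq_intros \<Phi>)
    qed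
    moreover have "C * ln (L * z) - C * ln (z / L) = 2 * C * ln L"
      using z0 L by (simp add: ln_mult ln_div algebra_simps)
    ultimately show ?thesis unfolding \<Psi>_def by linarith
  qed
  have "((\<lambda>z. - ((f (z / L) - f (L * z)) / z)) has_integral \<Psi> b - \<Psi> a) {a..b}"
    using ab \<Psi> by (intro fundamental_theorem_of_calculus)
      (auto simp: has_real_derivative_iff_has_vector_derivative[symmetric] intro: has_field_derivative_at_within)
  then have "((\<lambda>z. (f (z / L) - f (L * z)) / z) has_integral - (\<Psi> b - \<Psi> a)) {a..b}"
    using has_integral_neg[of "\<lambda>z. - ((f (z / L) - f (L * z)) / z)"] by (simp only: minus_minus)
  then have "integral {a..b} (\<lambda>z. (f (z / L) - f (L * z)) / z) = - (\<Psi> b - \<Psi> a)"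
    by (rule integral_unique)
  then show ?thesis using \<Psi>_le[of a] \<Psi>_le[of b] ab by auto
qed

locale transport_solution =
  fixes \<theta> \<theta>\<^sub>t \<theta>\<^sub>x u :: "real \<Rightarrow> real \<Rightarrow> real" and T C :: real
  assumes T_pos: "0 < T"
    and cont: "continuous_on ({0..T} \<times> UNIV) (\<lambda>(t, x). \<theta> t x)"
    and cont_t: "continuous_on ({0..T} \<times> UNIV) (\<lambda>(t, x). \<theta>\<^sub>t t x)"
    and cont_x: "continuous_on ({0..T} \<times> UNIV) (\<lambda>(t, x). \<theta>\<^sub>x t x)"
    and deriv_t: "\<And>t x. t \<in> {0..T} \<Longrightarrow> ((\<lambda>s. \<theta> s x) has_real_derivative \<theta>\<^sub>t t x) (at t within {0..T})"
    and deriv_x: "\<And>t x. t \<in> {0..T} \<Longrightarrow> (\<theta> t has_real_derivative \<theta>\<^sub>x t x) (at x)"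
    and Hilbert: "\<And>t x. t \<in> {0..T} \<Longrightarrow> has_Hilbert_transform_at (\<theta> t) (u t x) x"
    and transport: "\<And>t x. t \<in> {0..T} \<Longrightarrow> \<theta>\<^sub>t t x + u t x * \<theta>\<^sub>x t x = 0"
    and bound: "\<And>t x. t \<in> {0..T} \<Longrightarrow> \<bar>\<theta> t x\<bar> \<le> C"
    and bound_x: "\<And>t x. t \<in> {0..T} \<Longrightarrow> \<bar>\<theta>\<^sub>x t x\<bar> \<le> C"
begin

lemma C_nonneg: "0 \<le> C"
  using bound[of 0 0] T_pos by simp

lemma cont_slice: "t \<in> {0..T} \<Longrightarrow> continuous_on UNIV (\<theta> t)"
  using DERIV_continuous[OF deriv_x] by (simp add: continuous_on_eq_continuous_within)

lemma Lipschitz: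
  assumes "t \<in> {0..T}"
  shows "\<bar>\<theta> t y - \<theta> t y'\<bar> \<le> C * \<bar>y - y'\<bar>"
  using field_differentiable_bound[of UNIV "\<theta> t" "\<theta>\<^sub>x t" C y y'] deriv_x[OF assms] bound_x[OF assms]
  by simp

lemma u_diff_le:
  assumes "t \<in> {0..T}"
  shows "\<bar>u t x - u t y\<bar> \<le> 2 * C * (1 + \<bar>x - y\<bar>)"
  using Hilbert_diff_le[OF cont_slice bound Lipschitz Hilbert Hilbert] assms by blast

text \<open>The truncated differences are continuous, and by \<open>Hilbert_diff_trunc_le\<close>
  they converge at the rate \<open>4 * C * (1 + |x - x0|) / real (Suc n)\<close>. Dividing by the
  weight \<open>1 + |x - x0|\<close> makes the convergence uniform on the whole strip.\<close>

lemma continuous_on_u_diff: "continuous_on ({0..T} \<times> UNIV) (\<lambda>(t, x). u t x - u t x0)"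
proof -
  let ?D = "\<lambda>n t x. trunc_Hilbert (\<theta> t) x (1 / real (Suc n)) (real (Suc n))"
  have D: "continuous_on ({0..T} \<times> UNIV) (\<lambda>p. ?D n (fst p) (snd p))" for n
    using trunc_Hilbert_continuous_on[OF cont, of "1 / real (Suc n)" "real (Suc n)"] by (simp add: split_beta)
  have D0: "continuous_on ({0..T} \<times> UNIV) (\<lambda>p :: real \<times> real. ?D n (fst p) x0)" for n
  proof -
    have c: "continuous_on ({0..T} \<times> (UNIV :: real set)) (\<lambda>p. (fst p, x0))"
      by (intro continuous_intros)
    have i: "(\<lambda>p. (fst p, x0)) ` ({0..T} \<times> (UNIV :: real set)) \<subseteq> {0..T} \<times> UNIV" by auto
    show ?thesis using continuous_on_compose2[OF D[of n] c i] by (simp only: fst_conv snd_conv)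
  qed
  have pos: "0 < 1 + \<bar>x\<bar>" for x :: real by (simp add: add_pos_nonneg)
  have "continuous_on ({0..T} \<times> UNIV) (\<lambda>p. pi * (u (fst p) (snd p) - u (fst p) x0) / (1 + \<bar>snd p - x0\<bar>))"
  proof (rule uniform_limit_theorem)
    show "\<forall>\<^sub>F n in sequentially. continuous_on ({0..T} \<times> UNIV)
      (\<lambda>p. (?D n (fst p) (snd p) - ?D n (fst p) x0) / (1 + \<bar>snd p - x0\<bar>))"
      using pos by (intro always_eventually allI continuous_intros D D0) (auto simp: less_imp_neq[symmetric] dest: less_imp_neq)
    show "uniform_limit ({0..T} \<times> UNIV)
      (\<lambda>n p. (?D n (fst p) (snd p) - ?D n (fst p) x0) / (1 + \<bar>snd p - x0\<bar>))
      (\<lambda>p. pi * (u (fst p) (snd p) - u (fst p) x0) / (1 + \<bar>snd p - x0\<bar>)) sequentially"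
      unfolding uniform_limit_sequentially_iff
    proof (intro allI impI)
      fix e :: real assume e: "0 < e"
      show "\<exists>N. \<forall>n\<ge>N. \<forall>p\<in>{0..T} \<times> UNIV.
        dist ((?D n (fst p) (snd p) - ?D n (fst p) x0) / (1 + \<bar>snd p - x0\<bar>))
          (pi * (u (fst p) (snd p) - u (fst p) x0) / (1 + \<bar>snd p - x0\<bar>)) < e"
      proof (intro exI[of _ "nat \<lceil>4 * C / e\<rceil>"] allI ballI impI)
        fix n and p :: "real \<times> real" assume n: "nat \<lceil>4 * C / e\<rceil> \<le> n" and "p \<in> {0..T} \<times> UNIV"
        then obtain t x where p: "p = (t, x)" "t \<in> {0..T}" by (cases p) auto
        have "4 * C / e < real (Suc n)" using n by linarith
        then have lt: "4 * C / real (Suc n) < e" using e by (simp add: field_simps)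
        have "1 / real (Suc n) \<le> 1" "1 \<le> real (Suc n)" by simp_all
        then have "1 / real (Suc n) \<le> real (Suc n)" by linarith
        then have "\<bar>pi * (u t x - u t x0) - (?D n t x - ?D n t x0)\<bar>
          \<le> 4 * C * (1 / real (Suc n)) + 4 * C * \<bar>x - x0\<bar> / real (Suc n)"
          using p(2) by (intro Hilbert_diff_trunc_le cont_slice bound Lipschitz Hilbert) auto
        also have "\<dots> = 4 * C / real (Suc n) * (1 + \<bar>x - x0\<bar>)"
          by (simp add: distrib_left)
        finally have "\<bar>pi * (u t x - u t x0) - (?D n t x - ?D n t x0)\<bar> / (1 + \<bar>x - x0\<bar>) \<le> 4 * C / real (Suc n)"
          using pos by (simp add: divide_le_eq)
        also have "\<dots> < e" by (rule lt)
        finally have "\<bar>(pi * (u t x - u t x0) - (?D n t x - ?D n t x0)) / (1 + \<bar>x - x0\<bar>)\<bar> < e"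
          using pos[of "x - x0"] by simp
        then show "dist ((?D n (fst p) (snd p) - ?D n (fst p) x0) / (1 + \<bar>snd p - x0\<bar>))
          (pi * (u (fst p) (snd p) - u (fst p) x0) / (1 + \<bar>snd p - x0\<bar>)) < e"
          unfolding p fst_conv snd_conv dist_real_def diff_divide_distrib[symmetric] abs_minus_commute[of "_ / _"]
          by (simp add: abs_minus_commute)
      qed
    qed
  qed auto
  moreover have "continuous_on ({0..T} \<times> UNIV) (\<lambda>p :: real \<times> real. 1 / pi * (1 + \<bar>snd p - x0\<bar>))"
    by (intro continuous_intros)
  ultimately have "continuous_on ({0..T} \<times> UNIV) (\<lambda>p. 1 / pi * (1 + \<bar>snd p - x0\<bar>) *
      (pi * (u (fst p) (snd p) - u (fst p) x0) / (1 + \<bar>snd p - x0\<bar>)))"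
    by (rule continuous_on_mult[rotated])
  moreover have "1 / pi * (1 + \<bar>snd p - x0\<bar>) *
      (pi * (u (fst p) (snd p) - u (fst p) x0) / (1 + \<bar>snd p - x0\<bar>)) = u (fst p) (snd p) - u (fst p) x0" for p
    using pos[of "snd p - x0"] by simp
  ultimately show ?thesis by (simp add: split_beta)
qed

text \<open>
  Where \<open>\<theta>\<^sub>x\<close> vanishes identically in \<open>x\<close> the equation says nothing about \<open>u\<close>, whose dependence on
  \<open>t\<close> is otherwise uncontrolled; elsewhere continuity in \<open>t\<close> comes from \<open>u = - \<theta>\<^sub>t / \<theta>\<^sub>x\<close>.
\<close>

lemma continuous_on_u:
  assumes S: "S \<subseteq> {0..T}" and live: "\<And>t. t \<in> S \<Longrightarrow> \<exists>x. \<theta>\<^sub>x t x \<noteq> 0"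
  shows "continuous_on (S \<times> UNIV) (\<lambda>(t, x). u t x)"
  unfolding continuous_on_eq_continuous_within
proof
  fix p :: "real \<times> real" assume "p \<in> S \<times> UNIV"
  then obtain t0 x0 where p: "p = (t0, x0)" and t0: "t0 \<in> S" by (cases p) auto
  \<comment> \<open>One point with nonzero slope is enough: it gives continuity of
    \<open>u t y\<close> in \<open>t\<close>, and the differences \<open>u t x - u t y\<close> are
    already known to be jointly continuous.\<close>
  obtain y where y: "\<theta>\<^sub>x t0 y \<noteq> 0" using live[OF t0] by blast
  have slice: "continuous_on S (\<lambda>t. h t y)"
    if "continuous_on ({0..T} \<times> UNIV) (\<lambda>(t, x). h t x)" for h :: "real \<Rightarrow> real \<Rightarrow> real"
    by (rule continuous_on_compose2[OF that, where f="\<lambda>t. (t, y)", unfolded split_beta, simplified])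
      (use S in \<open>auto intro!: continuous_intros\<close>)
  have lim: "((\<lambda>t. - \<theta>\<^sub>t t y / \<theta>\<^sub>x t y) \<longlongrightarrow> - \<theta>\<^sub>t t0 y / \<theta>\<^sub>x t0 y) (at t0 within S)"
    using slice[OF cont_t] slice[OF cont_x] t0 y
    by (intro tendsto_intros) (auto simp: continuous_on_def)
  have "\<forall>\<^sub>F t in at t0 within S. \<theta>\<^sub>x t y \<noteq> 0"
    using slice[OF cont_x] t0 y by (intro tendsto_imp_eventually_ne) (auto simp: continuous_on_def)
  moreover have "\<forall>\<^sub>F t in at t0 within S. t \<in> S" by (simp add: eventually_at_filter)
  moreover have u_eq: "- \<theta>\<^sub>t t y / \<theta>\<^sub>x t y = u t y" if "\<theta>\<^sub>x t y \<noteq> 0" "t \<in> S" for t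
    using transport[of t y] that S by (auto simp: field_simps)
  ultimately have "\<forall>\<^sub>F t in at t0 within S. - \<theta>\<^sub>t t y / \<theta>\<^sub>x t y = u t y"
    by (auto elim: eventually_elim2)
  then have "((\<lambda>t. u t y) \<longlongrightarrow> u t0 y) (at t0 within S)"
    using lim u_eq[OF y t0] Lim_transform_eventually by fastforce
  then have "continuous (at t0 within S) (\<lambda>t. u t y)" by (simp add: continuous_within)
  then have "continuous (at t0 within fst ` (S \<times> (UNIV :: real set))) (\<lambda>t. u t y)" by simp
  then have "continuous (at (t0, x0) within S \<times> UNIV) (\<lambda>p. u (fst p) y)"
    by (intro continuous_within_compose2[of _ _ fst "\<lambda>t. u t y"]) (auto intro!: continuous_intros)
  moreover have "continuous (at (t0, x0) within S \<times> UNIV) (\<lambda>p. u (fst p) (snd p) - u (fst p) y)"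
    using continuous_on_subset[OF continuous_on_u_diff, of "S \<times> UNIV" y] S t0
    by (auto simp: continuous_on_eq_continuous_within split_beta)
  ultimately have "continuous (at (t0, x0) within S \<times> UNIV) (\<lambda>p. (u (fst p) (snd p) - u (fst p) y) + u (fst p) y)"
    by (rule continuous_add[rotated])
  then show "continuous (at p within S \<times> UNIV) (\<lambda>(t, x). u t x)"
    unfolding p split_beta by simp
qed

section \<open>Trajectories of the solution\<close>

definition live :: "real \<Rightarrow> bool" where
  "live \<tau> \<longleftrightarrow> 0 \<le> \<tau> \<and> \<tau> \<le> T \<and> (\<forall>t\<in>{0..\<tau>}. \<exists>x. \<theta>\<^sub>x t x \<noteq> 0)"

definition curve :: "real \<Rightarrow> (real \<Rightarrow> real) \<Rightarrow> bool" where
  "curve \<tau> X \<longleftrightarrow> (\<forall>t\<in>{0..\<tau>}. (X has_real_derivative u t (X t)) (at t within {0..\<tau>}))"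

lemma live_mono: "live \<tau> \<Longrightarrow> 0 \<le> s \<Longrightarrow> s \<le> \<tau> \<Longrightarrow> live s"
  by (auto simp: live_def)

lemma curve_mono: "curve \<tau> X \<Longrightarrow> s \<le> \<tau> \<Longrightarrow> curve s X"
  unfolding curve_def by (meson atLeastAtMost_iff atLeastatMost_subset_iff has_field_derivative_subset order_refl order_trans)

lemma curve_continuous: "curve \<tau> X \<Longrightarrow> continuous_on {0..\<tau>} X"
  unfolding curve_def continuous_on_eq_continuous_within by (auto intro: DERIV_continuous)

text \<open>This is the purpose of \<open>live\<close>: trajectories are built only up to a time
  until which the equation pins down the velocity. \<open>live_T\<close> removes the restriction
  afterwards.\<close>

lemma live_continuous_on_u: "live \<tau> \<Longrightarrow> continuous_on ({0..\<tau>} \<times> UNIV) (\<lambda>(t, x). u t x)"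
  by (rule continuous_on_u) (auto simp: live_def)

text \<open>Here \<open>K\<close> comes from compactness of \<open>{0..\<tau>}\<close> and depends
  on \<open>\<tau>\<close> without control. It serves the existence of curves only; quantitative
  bounds use velocity differences or \<open>center_velocity_le\<close>.\<close>

lemma live_u_linear_growth:
  assumes "live \<tau>"
  obtains K where "\<And>t x. t \<in> {0..\<tau>} \<Longrightarrow> \<bar>u t x\<bar> \<le> K * (1 + \<bar>x\<bar>)"
proof -
  have "continuous_on {0..\<tau>} (\<lambda>t. u t 0)"
    by (rule continuous_on_compose2[OF live_continuous_on_u[OF assms], where f="\<lambda>t. (t, 0)", unfolded split_beta, simplified])
      (auto intro!: continuous_intros)
  then have "bounded ((\<lambda>t. u t 0) ` {0..\<tau>})"
    by (intro compact_imp_bounded compact_continuous_image) auto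
  then obtain B where "\<forall>y\<in>(\<lambda>t. u t 0) ` {0..\<tau>}. norm y \<le> B" unfolding bounded_iff by blast
  then have B: "\<bar>u t 0\<bar> \<le> B" if "t \<in> {0..\<tau>}" for t using that by simp
  show thesis
  proof (rule that[of "B + 2 * C"])
    fix t x assume t: "t \<in> {0..\<tau>}"
    then have tT: "t \<in> {0..T}" using assms by (auto simp: live_def)
    have "0 \<le> B * \<bar>x\<bar>" using B[OF t] by (intro mult_nonneg_nonneg) auto
    then have "B + 2 * C * (1 + \<bar>x\<bar>) \<le> (B + 2 * C) * (1 + \<bar>x\<bar>)" by (simp add: algebra_simps)
    moreover have "\<bar>u t x\<bar> \<le> B + 2 * C * (1 + \<bar>x\<bar>)"
      using B[OF t] u_diff_le[OF tT, of x 0] unfolding diff_0_right by linarith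
    ultimately show "\<bar>u t x\<bar> \<le> (B + 2 * C) * (1 + \<bar>x\<bar>)" by linarith
  qed
qed

lemma forward_curve:
  assumes "live \<tau>"
  obtains X where "X 0 = x0" "curve \<tau> X"
proof -
  obtain K where K: "\<And>t x. t \<in> {0..\<tau>} \<Longrightarrow> \<bar>u t x\<bar> \<le> K * (1 + \<bar>x\<bar>)"
    using live_u_linear_growth[OF assms] by blast
  show thesis
    by (rule Peano_linear_growth[OF live_continuous_on_u[OF assms] K, of x0])
      (use assms that in \<open>auto simp: live_def curve_def\<close>)
qed

text \<open>Reversing time traces any point at time \<open>\<tau>\<close> back to a starting point,
  which plays the role of surjectivity of a flow map.\<close>

lemma backward_curve:
  assumes "live \<tau>"
  obtains X where "X \<tau> = x0" "curve \<tau> X"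
proof -
  obtain K where K: "\<And>t x. t \<in> {0..\<tau>} \<Longrightarrow> \<bar>u t x\<bar> \<le> K * (1 + \<bar>x\<bar>)"
    using live_u_linear_growth[OF assms] by blast
  have \<tau>: "0 \<le> \<tau>" using assms by (simp add: live_def)
  have "continuous_on ({0..\<tau>} \<times> UNIV) (\<lambda>p. u (\<tau> - fst p) (snd p))"
    by (rule continuous_on_compose2[OF live_continuous_on_u[OF assms], where f="\<lambda>p. (\<tau> - fst p, snd p)", unfolded split_beta, simplified])
      (auto intro!: continuous_intros)
  then have c: "continuous_on ({0..\<tau>} \<times> UNIV) (\<lambda>(t, x). - u (\<tau> - t) x)"
    unfolding split_beta by (rule continuous_on_minus)
  obtain Y where Y: "Y 0 = x0" "\<And>t. t \<in> {0..\<tau>} \<Longrightarrow> (Y has_real_derivative - u (\<tau> - t) (Y t)) (at t within {0..\<tau>})"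
  proof (rule Peano_linear_growth[OF c _ \<tau>, of K x0])
    show "\<bar>- u (\<tau> - t) x\<bar> \<le> K * (1 + \<bar>x\<bar>)" if "t \<in> {0..\<tau>}" for t x
      using K[of "\<tau> - t" x] that by simp
  qed (rule that)
  have img: "(\<lambda>t. \<tau> - t) ` {0..\<tau>} = {0..\<tau>}" using \<tau> by auto
  show thesis
  proof (rule that[of "\<lambda>t. Y (\<tau> - t)"])
    show "Y (\<tau> - \<tau>) = x0" using Y(1) by simp
    show "curve \<tau> (\<lambda>t. Y (\<tau> - t))"
      unfolding curve_def
    proof
      fix t assume t: "t \<in> {0..\<tau>}"
      have "(Y has_real_derivative - u t (Y (\<tau> - t))) (at (\<tau> - t) within (\<lambda>t. \<tau> - t) ` {0..\<tau>})"
        using Y(2)[of "\<tau> - t"] t img by simp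
      moreover have "((\<lambda>t. \<tau> - t) has_real_derivative - 1) (at t within {0..\<tau>})"
        by (auto intro!: derivative_eq_intros)
      ultimately have "((\<lambda>t. Y (\<tau> - t)) has_real_derivative - u t (Y (\<tau> - t)) * - 1) (at t within {0..\<tau>})"
        using DERIV_image_chain[of Y "- u t (Y (\<tau> - t))" "\<lambda>t. \<tau> - t" t "{0..\<tau>}" "-1"]
        unfolding o_def by blast
      then show "((\<lambda>t. Y (\<tau> - t)) has_real_derivative u t (Y (\<tau> - t))) (at t within {0..\<tau>})" by simp
    qed
  qed
qed

lemma constant_along:
  assumes X: "curve \<tau> X" and \<tau>: "\<tau> \<le> T" and st: "s \<in> {0..\<tau>}" "t \<in> {0..\<tau>}"
  shows "\<theta> t (X t) = \<theta> s (X s)"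
proof (rule constant_along_curve[where T=\<tau> and \<theta>=\<theta> and \<theta>\<^sub>t=\<theta>\<^sub>t and \<theta>\<^sub>x=\<theta>\<^sub>x and V="\<lambda>t. u t (X t)"])
  show "continuous_on ({0..\<tau>} \<times> UNIV) (\<lambda>(t, x). \<theta>\<^sub>x t x)"
    using \<tau> by (intro continuous_on_subset[OF cont_x]) auto
  show "((\<lambda>s. \<theta> s x) has_real_derivative \<theta>\<^sub>t t x) (at t within {0..\<tau>})" if "t \<in> {0..\<tau>}" for t x
    using deriv_t[of t x] that \<tau> by (auto intro: has_field_derivative_subset)
qed (use X \<tau> st deriv_x transport in \<open>auto simp: curve_def\<close>)

text \<open>Only velocity differences enter, so the constant depends on \<open>C\<close> and
  \<open>T\<close> alone and is uniform over all \<open>\<tau> \<le> T\<close>.\<close>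

lemma curve_diff_growth:
  assumes "curve \<tau> X" "curve \<tau> Y" "\<tau> \<le> T" and st: "s \<in> {0..\<tau>}" "t \<in> {0..\<tau>}"
  shows "\<bar>ln (1 + (X t - Y t) ^ 2) - ln (1 + (X s - Y s) ^ 2)\<bar> \<le> 8 * C * T"
proof -
  have "\<bar>ln (1 + (X t - Y t) ^ 2) - ln (1 + (X s - Y s) ^ 2)\<bar> \<le> 4 * (2 * C) * \<bar>t - s\<bar>"
  proof (rule ln_one_plus_square_growth[where D="\<lambda>t. X t - Y t" and D'="\<lambda>t. u t (X t) - u t (Y t)"])
    show "((\<lambda>t. X t - Y t) has_real_derivative u t (X t) - u t (Y t)) (at t within {0..\<tau>})"
      if "t \<in> {0..\<tau>}" for t
      using assms(1,2) that unfolding curve_def by (auto intro: DERIV_diff)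
    show "\<bar>u t (X t) - u t (Y t)\<bar> \<le> 2 * C * (1 + \<bar>X t - Y t\<bar>)" if "t \<in> {0..\<tau>}" for t
      using u_diff_le[of t] that assms(3) by simp
  qed (use st in auto)
  also have "\<dots> \<le> 4 * (2 * C) * T"
    using st assms(3) C_nonneg by (intro mult_left_mono) auto
  finally show ?thesis by simp
qed

end

subsection \<open>Even decreasing data\<close>

locale even_decreasing_solution = transport_solution +
  assumes even: "\<And>x. \<theta> 0 (- x) = \<theta> 0 x"
    and nonneg: "\<And>x. 0 \<le> \<theta> 0 x"
    and antimono: "antimono_on {0<..} (\<theta> 0)"
    and decay: "(\<theta> 0 \<longlongrightarrow> 0) at_infinity"
    and nonconstant: "\<not> \<theta> 0 constant_on UNIV"
begin

lemma initial_le: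
  assumes "\<bar>x\<bar> \<le> \<bar>y\<bar>"
  shows "\<theta> 0 y \<le> \<theta> 0 x"
proof -
  have pos: "\<theta> 0 q \<le> \<theta> 0 p" if "0 < p" "p \<le> q" for p q
    using antimono that by (auto simp: monotone_on_def)
  have nonneg_le: "\<theta> 0 q \<le> \<theta> 0 p" if "0 \<le> p" "p \<le> q" for p q
  proof (cases "p = 0 \<and> 0 < q")
    case True
    \<comment> \<open>Monotonicity is given on the open half-line; the comparison with the value at
      the origin is obtained as a right limit.\<close>
    have "isCont (\<theta> 0) 0"
      using cont_slice[of 0] T_pos by (simp add: continuous_on_eq_continuous_at)
    then have "(\<theta> 0 \<longlongrightarrow> \<theta> 0 0) (at_right 0)"
      by (simp add: isCont_def filterlim_at_split)
    moreover have "\<forall>\<^sub>F s in at_right 0. \<theta> 0 q \<le> \<theta> 0 s"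
      unfolding eventually_at_right_field using True pos by (intro exI[of _ q]) auto
    ultimately show ?thesis using True tendsto_lowerbound[of "\<theta> 0" "\<theta> 0 0" "at_right 0" "\<theta> 0 q"] by simp
  next
    case False
    then show ?thesis using that pos[of p q] by (cases "p = q") auto
  qed
  have abs: "\<theta> 0 \<bar>z\<bar> = \<theta> 0 z" for z using even[of z] by (simp add: abs_if)
  show ?thesis using nonneg_le[of "\<bar>x\<bar>" "\<bar>y\<bar>"] assms unfolding abs by simp
qed

lemma max_pos: "0 < \<theta> 0 0"
proof (rule ccontr)
  assume "\<not> 0 < \<theta> 0 0"
  then have "\<theta> 0 x = 0" for x using initial_le[of 0 x] nonneg[of x] by simp
  then show False using nonconstant by (simp add: constant_on_def)
qed

lemma attains_level:
  assumes "0 < b" "b < \<theta> 0 0"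
  obtains x where "0 < x" "\<theta> 0 x = b"
proof -
  have "\<forall>\<^sub>F x in at_infinity. \<theta> 0 x < b" using decay assms(1) by (auto simp: order_tendsto_iff)
  then obtain N where N: "\<And>x. N \<le> \<bar>x\<bar> \<Longrightarrow> \<theta> 0 x < b" unfolding eventually_at_infinity by auto
  have "\<exists>x\<ge>0. x \<le> \<bar>N\<bar> \<and> \<theta> 0 x = b"
    using N[of "\<bar>N\<bar>"] assms cont_slice[of 0] T_pos
    by (intro IVT2') (auto intro: continuous_on_subset less_imp_le)
  then obtain x where "0 \<le> x" "\<theta> 0 x = b" by blast
  with assms(2) have "0 < x" by (cases "x = 0") auto
  then show thesis using \<open>\<theta> 0 x = b\<close> by (rule that)
qed

text \<open>Trajectories distort \<open>1 + d ^ 2\<close>, with \<open>d\<close> the distance of two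
  of them, by at most \<open>exp (8 * C * T)\<close>. The extra factor 2 absorbs the summand 1 once
  \<open>d\<close> is at least \<open>stretch\<close>, turning this into a distortion of
  \<open>d\<close> itself by \<open>stretch\<close>.\<close>

definition stretch :: real where
  "stretch = sqrt (2 * exp (8 * C * T))"

lemma stretch_ge_1: "1 \<le> stretch"
  using C_nonneg T_pos unfolding stretch_def by (intro real_le_rsqrt) (simp add: order_trans[of 1 2])

text \<open>
  Seen from the image of the origin, distances are distorted by at most a constant factor, so the
  far field of \<open>\<theta> t\<close> is squeezed between two dilates of the datum.
\<close>

lemma far_field_bounds:
  assumes lv: "live t" and a: "curve t a" "a 0 = 0" and w: "stretch \<le> \<bar>w\<bar>"
  shows "\<theta> 0 (stretch * \<bar>w\<bar>) \<le> \<theta> t (a t + w)" "\<theta> t (a t + w) \<le> \<theta> 0 (\<bar>w\<bar> / stretch)"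
proof -
  define L E where "L = stretch" and "E = exp (8 * C * T)"
  have t: "0 \<le> t" "t \<le> T" using lv by (auto simp: live_def)
  have L: "1 \<le> L" "L ^ 2 = 2 * E" using stretch_ge_1 by (auto simp: L_def E_def stretch_def)
  obtain Y where Y: "Y t = a t + w" "curve t Y" using backward_curve[OF lv] by blast
  have eq: "\<theta> t (a t + w) = \<theta> 0 (Y 0)" using constant_along[OF Y(2) t(2), of 0 t] t Y(1) by simp
  have pos: "0 < 1 + x ^ 2" for x :: real by (simp add: add_pos_nonneg)
  have "\<bar>ln (1 + w ^ 2) - ln (1 + Y 0 ^ 2)\<bar> \<le> 8 * C * T"
    using curve_diff_growth[OF Y(2) a(1) t(2), of 0 t] t Y(1) a(2) by simp
  then have "ln (1 + w ^ 2) \<le> ln (1 + Y 0 ^ 2) + 8 * C * T" "ln (1 + Y 0 ^ 2) \<le> ln (1 + w ^ 2) + 8 * C * T"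
    by (auto simp: abs_le_iff)
  then have "exp (ln (1 + w ^ 2)) \<le> exp (ln (1 + Y 0 ^ 2) + 8 * C * T)"
    "exp (ln (1 + Y 0 ^ 2)) \<le> exp (ln (1 + w ^ 2) + 8 * C * T)" by simp_all
  then have le: "1 + w ^ 2 \<le> (1 + Y 0 ^ 2) * E" "1 + Y 0 ^ 2 \<le> (1 + w ^ 2) * E"
    using pos by (simp_all add: exp_add E_def)
  have "L ^ 2 \<le> \<bar>w\<bar> ^ 2" using w L by (intro power_mono) (auto simp: L_def)
  then have wE: "2 * E \<le> w ^ 2" using L by simp
  have E1: "1 \<le> E" using C_nonneg T_pos by (simp add: E_def)
  have "1 + Y 0 ^ 2 \<le> (w ^ 2 + w ^ 2) * E"
    using le(2) mult_right_mono[of "1 + w ^ 2" "w ^ 2 + w ^ 2" E] wE E1 by linarith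
  then have "Y 0 ^ 2 \<le> (L * w) ^ 2" using L(2) by (simp add: power_mult_distrib algebra_simps)
  then have "\<bar>Y 0\<bar> \<le> \<bar>L * w\<bar>" by (simp add: abs_le_square_iff)
  then show "\<theta> 0 (stretch * \<bar>w\<bar>) \<le> \<theta> t (a t + w)"
    unfolding eq using L by (intro initial_le) (simp add: abs_mult L_def)
  have "w ^ 2 \<le> (L * Y 0) ^ 2"
    using le(1) wE L(2) by (simp add: power_mult_distrib algebra_simps)
  then have "\<bar>w\<bar> \<le> \<bar>L * Y 0\<bar>" by (simp add: abs_le_square_iff)
  then show "\<theta> t (a t + w) \<le> \<theta> 0 (\<bar>w\<bar> / stretch)"
    unfolding eq using L by (intro initial_le) (simp add: abs_mult L_def divide_le_eq mult.commute)
qed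

text \<open>Within \<open>stretch\<close> the Lipschitz bound applies. Farther out, the values on
  both sides of the centre lie between the same two dilates of the even datum, so the integrand is
  dominated by a Frullani integrand, of size \<open>ln stretch\<close> regardless of the outer
  cutoff. The result does not depend on \<open>t\<close>.\<close>

lemma center_velocity_le:
  assumes lv: "live t" and a: "curve t a" "a 0 = 0"
  shows "\<bar>pi * u t (a t)\<bar> \<le> 2 * C * stretch + 4 * C * ln stretch"
proof (rule Lim_bounded)
  let ?S = "\<lambda>n. trunc_Hilbert (\<theta> t) (a t) (1 / real (Suc n)) (real (Suc n))"
  have t: "t \<in> {0..T}" using lv by (auto simp: live_def)
  note c = cont_slice[OF t] and L1 = stretch_ge_1
  have c0: "continuous_on UNIV (\<theta> 0)" using cont_slice[of 0] T_pos by simp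
  show "(\<lambda>n. \<bar>?S n\<bar>) \<longlonglongrightarrow> \<bar>pi * u t (a t)\<bar>"
    by (intro tendsto_rabs trunc_Hilbert_LIMSEQ Hilbert t c)
  show "\<forall>n\<ge>nat \<lceil>stretch\<rceil>. \<bar>?S n\<bar> \<le> 2 * C * stretch + 4 * C * ln stretch"
  proof (intro allI impI)
    fix n assume n: "nat \<lceil>stretch\<rceil> \<le> n"
    define R e where "R = real (Suc n)" and "e = 1 / R"
    have R: "stretch \<le> R" "1 \<le> R" using n L1 unfolding R_def by linarith+
    then have "0 < e" "e \<le> 1" by (auto simp: e_def divide_le_eq)
    then have e: "0 < e" "e \<le> stretch" using L1 by auto
    let ?q = "\<lambda>z. (\<theta> t (a t + z) - \<theta> t (a t - z)) / z"
    let ?p = "\<lambda>z. (\<theta> 0 (z / stretch) - \<theta> 0 (stretch * z)) / z"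
    have "\<bar>trunc_Hilbert (\<theta> t) (a t) e stretch\<bar> \<le> 2 * C * (stretch - e)"
      using trunc_Hilbert_near_le[OF c Lipschitz[OF t]] e by blast
    also have "\<dots> \<le> 2 * C * stretch" using e C_nonneg by (intro mult_left_mono) auto
    finally have near: "\<bar>trunc_Hilbert (\<theta> t) (a t) e stretch\<bar> \<le> 2 * C * stretch" .
    have "norm (integral {stretch..R} ?q) \<le> integral {stretch..R} ?p"
    proof (rule integral_norm_bound_integral)
      show "?q integrable_on {stretch..R}" using trunc_Hilbert_integrable[OF c] L1 by simp
      show "?p integrable_on {stretch..R}"
        using L1 by (intro integrable_continuous_interval)
          (auto intro!: continuous_intros continuous_on_compose2[OF c0])
      show "norm (?q z) \<le> ?p z" if z: "z \<in> {stretch..R}" for z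
      proof -
        have "0 < z" using z L1 by auto
        then show ?thesis
          using far_field_bounds[OF lv a, of z] far_field_bounds[OF lv a, of "- z"] z L1
          by (auto simp: abs_le_iff intro!: divide_right_mono)
      qed
    qed
    also have "\<dots> \<le> 4 * C * ln stretch"
      using abs_Frullani_integral_le[OF c0 _ L1, of C stretch R] bound[of 0] T_pos L1 R by simp
    finally have far: "\<bar>trunc_Hilbert (\<theta> t) (a t) stretch R\<bar> \<le> 4 * C * ln stretch"
      by (simp add: trunc_Hilbert_def)
    have "?S n = trunc_Hilbert (\<theta> t) (a t) e stretch + trunc_Hilbert (\<theta> t) (a t) stretch R"
      using trunc_Hilbert_combine[OF c e R(1)] by (simp add: R_def e_def)
    with near far show "\<bar>?S n\<bar> \<le> 2 * C * stretch + 4 * C * ln stretch" by linarith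
  qed
qed

section \<open>No time slice becomes constant\<close>

lemma nonconstant_slice_iff:
  assumes "t \<in> {0..T}"
  shows "(\<exists>x. \<theta>\<^sub>x t x \<noteq> 0) \<longleftrightarrow> \<not> \<theta> t constant_on UNIV"
proof
  assume "\<not> \<theta> t constant_on UNIV"
  then show "\<exists>x. \<theta>\<^sub>x t x \<noteq> 0"
    using has_field_derivative_zero_constant[of UNIV "\<theta> t"] deriv_x[OF assms]
    by (fastforce simp: constant_on_def)
next
  assume "\<exists>x. \<theta>\<^sub>x t x \<noteq> 0"
  then obtain x where x: "\<theta>\<^sub>x t x \<noteq> 0" by blast
  show "\<not> \<theta> t constant_on UNIV"
  proof
    assume "\<theta> t constant_on UNIV"
    then obtain k where "\<theta> t = (\<lambda>_. k)" by (auto simp: constant_on_def)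
    then show False using DERIV_unique[OF deriv_x[OF assms, of x], of 0] x by simp
  qed
qed

text \<open>
  At the first time at which \<open>\<theta> t\<close> is constant the non-constant part would have to have escaped to
  infinity, which the bound on the velocity at the centre excludes.
\<close>

lemma live_T: "live T"
proof (rule ccontr)
  assume not_live: "\<not> live T"
  define Z where "Z = (\<Inter>x. {t \<in> {0..T}. \<theta>\<^sub>x t x = 0})"
  have "closed {t \<in> {0..T}. \<theta>\<^sub>x t x = 0}" for x
  proof (rule continuous_closed_preimage_constant)
    show "continuous_on {0..T} (\<lambda>t. \<theta>\<^sub>x t x)"
      by (rule continuous_on_compose2[OF cont_x, where f="\<lambda>t. (t, x)", unfolded split_beta, simplified])
        (auto intro!: continuous_intros)
  qed auto
  then have "closed Z" unfolding Z_def by (intro closed_INT) auto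
  moreover have "Z \<subseteq> {0..T}" by (auto simp: Z_def)
  ultimately have "compact Z" using compact_Icc closed_Int_compact[of Z "{0..T}"] by (simp add: Int_absorb2)
  moreover have "Z \<noteq> {}" using not_live T_pos by (auto simp: live_def Z_def)
  ultimately obtain \<tau> where \<tau>: "\<tau> \<in> Z" and min: "\<And>t. t \<in> Z \<Longrightarrow> \<tau> \<le> t"
    using compact_attains_inf[of Z] by metis
  have \<tau>T: "\<tau> \<in> {0..T}" "\<And>x. \<theta>\<^sub>x \<tau> x = 0" using \<tau> by (auto simp: Z_def)
  have "\<tau> \<noteq> 0" using nonconstant_slice_iff[of 0] nonconstant \<tau>T by auto
  then have \<tau>0: "0 < \<tau>" using \<tau>T by simp
  have live: "live s" if "0 \<le> s" "s < \<tau>" for s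
    using min that \<tau>T(1) unfolding live_def Z_def by force
  obtain k where k: "\<And>x. \<theta> \<tau> x = k"
    using nonconstant_slice_iff[OF \<tau>T(1)] \<tau>T(2) by (auto simp: constant_on_def)
  obtain x1 where x1: "\<theta> 0 x1 \<noteq> \<theta> 0 0" using nonconstant by (auto simp: constant_on_def)
  define V where "V = 2 * C * stretch + 4 * C * ln stretch"
  have V0: "0 \<le> V" using C_nonneg stretch_ge_1 by (simp add: V_def)
  \<comment> \<open>The centre drifts by at most \<open>V * T\<close>, and the trajectory from
    \<open>x1\<close> stays within the square root of it. Up to any time before
    \<open>\<tau>\<close>, two distinct values of the datum thus remain visible in the fixed window
    \<open>{- N..N}\<close>.\<close>
  define N where "N = V * T + sqrt ((1 + x1 ^ 2) * exp (8 * C * T))"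
  have confined: "\<exists>y y'. \<bar>y\<bar> \<le> N \<and> \<bar>y'\<bar> \<le> N \<and> \<theta> s y = \<theta> 0 0 \<and> \<theta> s y' = \<theta> 0 x1"
    if s: "0 \<le> s" "s < \<tau>" for s
  proof -
    have sT: "s \<le> T" using s \<tau>T by simp
    obtain a where a: "a 0 = 0" "curve s a" using forward_curve[OF live[OF s]] by blast
    obtain X where X: "X 0 = x1" "curve s X" using forward_curve[OF live[OF s]] by blast
    have vel: "\<bar>u t (a t)\<bar> \<le> V" if "t \<in> {0..s}" for t
    proof -
      have "\<bar>pi * u t (a t)\<bar> \<le> V"
        unfolding V_def using that a live_mono[OF live[OF s], of t] curve_mono[OF a(2), of t]
        by (intro center_velocity_le) auto
      moreover have "1 * \<bar>u t (a t)\<bar> \<le> pi * \<bar>u t (a t)\<bar>"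
        using pi_ge_two by (intro mult_right_mono) auto
      ultimately show ?thesis by (simp add: abs_mult)
    qed
    have "norm (a s - a 0) \<le> V * norm (s - 0)"
      using vel a(2) s by (intro field_differentiable_bound[of "{0..s}" a "\<lambda>t. u t (a t)"]) (auto simp: curve_def)
    also have "\<dots> \<le> V * T" using s sT V0 by (intro mult_left_mono) auto
    finally have as: "\<bar>a s\<bar> \<le> V * T" using a by simp
    have pos: "0 < 1 + x ^ 2" for x :: real by (simp add: add_pos_nonneg)
    have "\<bar>ln (1 + (X s - a s) ^ 2) - ln (1 + x1 ^ 2)\<bar> \<le> 8 * C * T"
      using curve_diff_growth[OF X(2) a(2) sT, of 0 s] s X(1) a(1) by simp
    then have "ln (1 + (X s - a s) ^ 2) \<le> ln (1 + x1 ^ 2) + 8 * C * T" by (auto simp: abs_le_iff)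
    then have "exp (ln (1 + (X s - a s) ^ 2)) \<le> exp (ln (1 + x1 ^ 2) + 8 * C * T)" by simp
    then have "1 + (X s - a s) ^ 2 \<le> (1 + x1 ^ 2) * exp (8 * C * T)"
      using pos by (simp add: exp_add)
    then have "\<bar>X s - a s\<bar> \<le> sqrt ((1 + x1 ^ 2) * exp (8 * C * T))"
      by (intro real_le_rsqrt) simp
    with as have "\<bar>a s\<bar> \<le> N" "\<bar>X s\<bar> \<le> N" unfolding N_def by linarith+
    moreover have "\<theta> s (a s) = \<theta> 0 0" "\<theta> s (X s) = \<theta> 0 x1"
      using constant_along[OF a(2) sT, of 0 s] constant_along[OF X(2) sT, of 0 s] s a(1) X(1) by auto
    ultimately show ?thesis by blast
  qed
  \<comment> \<open>Half the gap between the two values: shortly before \<open>\<tau>\<close>,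
    uniform continuity on the window puts both of them within \<open>e\<close> of the constant
    \<open>k\<close>, which is impossible.\<close>
  define e where "e = \<bar>\<theta> 0 0 - \<theta> 0 x1\<bar> / 2"
  have e: "0 < e" using x1 by (simp add: e_def)
  have "continuous_on ({0..\<tau>} \<times> {- N..N}) (\<lambda>(t, x). \<theta> t x)"
    using \<tau>T by (intro continuous_on_subset[OF cont]) auto
  then have "uniformly_continuous_on ({0..\<tau>} \<times> {- N..N}) (\<lambda>(t, x). \<theta> t x)"
    by (intro compact_uniformly_continuous compact_Times compact_Icc)
  then obtain d where d: "0 < d" and unif: "\<And>p p'. p \<in> {0..\<tau>} \<times> {- N..N} \<Longrightarrow> p' \<in> {0..\<tau>} \<times> {- N..N} \<Longrightarrow>
      dist p' p < d \<Longrightarrow> dist (case p' of (t, x) \<Rightarrow> \<theta> t x) (case p of (t, x) \<Rightarrow> \<theta> t x) < e"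
    using e unfolding uniformly_continuous_on_def by metis
  define s where "s = max 0 (\<tau> - d / 2)"
  have s: "0 \<le> s" "s < \<tau>" "\<bar>s - \<tau>\<bar> < d" using d \<tau>0 by (auto simp: s_def)
  have near: "\<bar>\<theta> s y - k\<bar> < e" if "\<bar>y\<bar> \<le> N" for y
  proof -
    have "y \<in> {- N..N}" using that by auto
    then show ?thesis
      using unif[of "(\<tau>, y)" "(s, y)"] s k[of y] \<tau>0 by (auto simp: dist_Pair_Pair dist_real_def)
  qed
  obtain y y' where "\<bar>y\<bar> \<le> N" "\<bar>y'\<bar> \<le> N" "\<theta> s y = \<theta> 0 0" "\<theta> s y' = \<theta> 0 x1"
    using confined[OF s(1,2)] by blast
  then have "\<bar>\<theta> 0 0 - k\<bar> < e" "\<bar>\<theta> 0 x1 - k\<bar> < e" using near[of y] near[of y'] by auto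
  then show False unfolding e_def by (auto simp: abs_if split: if_splits)
qed

section \<open>Order of trajectories and transport of superlevel sets\<close>

lemma live: "t \<in> {0..T} \<Longrightarrow> live t"
  using live_mono[OF live_T] by simp

text \<open>The disjunction is what remains of order preservation when trajectories may merge and
  branch. It suffices because the curves are used only to compare values of
  \<open>\<theta>\<close>.\<close>

lemma curve_crossing:
  assumes X: "curve \<tau> X" and Y: "curve \<tau> Y" and \<tau>: "\<tau> \<in> {0..T}" and le: "Y \<tau> \<le> X \<tau>"
  shows "Y 0 \<le> X 0 \<or> \<theta> \<tau> (X \<tau>) = \<theta> \<tau> (Y \<tau>)"
proof (rule disjCI)
  assume ne: "\<theta> \<tau> (X \<tau>) \<noteq> \<theta> \<tau> (Y \<tau>)"
  show "Y 0 \<le> X 0"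
  proof (rule ccontr)
    assume "\<not> Y 0 \<le> X 0"
    then have "\<exists>s\<ge>0. s \<le> \<tau> \<and> X s - Y s = 0"
      using le \<tau> by (intro IVT' continuous_intros curve_continuous X Y) auto
    then obtain s where s: "s \<in> {0..\<tau>}" "X s = Y s" by auto
    have "\<theta> \<tau> (X \<tau>) = \<theta> \<tau> (Y \<tau>)"
      using constant_along[OF X, of s \<tau>] constant_along[OF Y, of s \<tau>] s \<tau> by simp
    with ne show False by simp
  qed
qed

lemma curve_less:
  assumes X: "curve T X" and Y: "curve T Y" and t: "t \<in> {0..T}"
    and less: "X 0 < Y 0" and ne: "\<theta> 0 (X 0) \<noteq> \<theta> 0 (Y 0)"
  shows "X t < Y t"
proof (rule ccontr)
  assume "\<not> X t < Y t"
  moreover have "curve t X" "curve t Y" using curve_mono X Y t by auto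
  ultimately have "\<theta> t (X t) = \<theta> t (Y t)" using curve_crossing[of t X Y] t less by auto
  then show False using constant_along[OF X, of 0 t] constant_along[OF Y, of 0 t] t ne by simp
qed

lemma level_value:
  assumes "curve T X" "t \<in> {0..T}"
  shows "\<theta> t (X t) = \<theta> 0 (X 0)"
  using constant_along[OF assms(1), of 0 t] assms(2) by simp

text \<open>A curve traced back from \<open>y\<close> either starts on the outer side of
  \<open>X 0\<close>, where the datum is smaller, or has met \<open>X\<close> and carries the same
  value.\<close>

lemma outside_level:
  assumes X: "curve T X" and t: "t \<in> {0..T}"
    and y: "0 \<le> X 0 \<and> X t \<le> y \<or> X 0 \<le> 0 \<and> y \<le> X t"
  shows "\<theta> t y \<le> \<theta> 0 (X 0)"
proof -
  obtain Y where Y: "Y t = y" "curve t Y" using backward_curve[OF live[OF t]] by blast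
  have Xt: "curve t X" using curve_mono X t by auto
  have eq: "\<theta> t y = \<theta> 0 (Y 0)" using constant_along[OF Y(2), of 0 t] t Y(1) by simp
  from y show ?thesis
  proof
    assume "0 \<le> X 0 \<and> X t \<le> y"
    then show ?thesis
      using curve_crossing[OF Y(2) Xt t] Y(1) level_value[OF X t] initial_le[of "X 0" "Y 0"] eq by auto
  next
    assume "X 0 \<le> 0 \<and> y \<le> X t"
    then show ?thesis
      using curve_crossing[OF Xt Y(2) t] Y(1) level_value[OF X t] initial_le[of "X 0" "Y 0"] eq by auto
  qed
qed

text \<open>Traced back, \<open>y\<close> starts between \<open>- r 0\<close> and \<open>r 0\<close>
  unless its curve met one of the two boundary curves, which carry the level itself. Evenness enters
  at time 0 only.\<close>

lemma inside_level:
  assumes r: "curve T r" and l: "curve T l" and eq0: "l 0 = - r 0" and t: "t \<in> {0..T}"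
    and y: "l t \<le> y" "y \<le> r t"
  shows "\<theta> 0 (r 0) \<le> \<theta> t y"
proof -
  obtain Y where Y: "Y t = y" "curve t Y" using backward_curve[OF live[OF t]] by blast
  have rt: "curve t r" "curve t l" using curve_mono r l t by auto
  have eq: "\<theta> t y = \<theta> 0 (Y 0)" using constant_along[OF Y(2), of 0 t] t Y(1) by simp
  have "\<theta> t y = \<theta> 0 (r 0) \<or> \<bar>Y 0\<bar> \<le> \<bar>r 0\<bar>"
    using curve_crossing[OF rt(1) Y(2) t] curve_crossing[OF Y(2) rt(2) t] Y(1) y eq0
      level_value[OF r t] level_value[OF l t] even[of "r 0"] by auto
  then show ?thesis using initial_le[of "Y 0" "r 0"] eq by auto
qed

lemma width_rate:
  assumes r: "curve T r" and l: "curve T l" and R: "curve T R"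
    and x: "r 0 = x" "l 0 = - x" "R 0 = y" "0 < x" "x < y"
    and b: "\<theta> 0 y < \<theta> 0 x" "\<theta> 0 x < \<theta> 0 0" and t: "t \<in> {0..T}"
  shows "pi * (u t (r t) - u t (l t)) \<le> - ((\<theta> 0 x - \<theta> 0 y) * (r t - l t) / (R t - l t))"
proof (rule Hilbert_contraction[OF cont_slice[OF t] Lipschitz[OF t] Hilbert[OF t] Hilbert[OF t]])
  \<comment> \<open>The curve from the origin carries the strict maximum, so neither boundary curve
    can meet it; it keeps the two apart and the width positive.\<close>
  obtain a where a: "a 0 = 0" "curve T a" using forward_curve[OF live_T] by blast
  have "l t < a t" "a t < r t" using curve_less[OF l a(2) t] curve_less[OF a(2) r t] a(1) x b even[of x] by auto
  then show "l t < r t" by simp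
  show "r t < R t" using curve_less[OF r R t] x b by auto
  show "\<theta> t (l t) = \<theta> 0 x" "\<theta> t (r t) = \<theta> 0 x"
    using level_value[OF r t] level_value[OF l t] x even[of x] by auto
  show "\<theta> 0 x \<le> \<theta> t y" if "l t \<le> y" "y \<le> r t" for y using inside_level[OF r l _ t that] x by simp
  show "\<theta> t y \<le> \<theta> 0 x" if "y \<le> l t" for y
    using outside_level[OF l t, of y] that x even[of x] by simp
  show "\<theta> t y \<le> \<theta> 0 x" if "r t \<le> y" for y
    using outside_level[OF r t, of y] that x by simp
  show "\<theta> t z \<le> \<theta> 0 y" if "R t \<le> z" for z
    using outside_level[OF R t, of z] that x by simp
  show "\<theta> 0 y \<le> \<theta> 0 x" using b by simp
qed

end

subsection \<open>Collapse of the level sets\<close>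

lemma nonincreasing_within:
  fixes f :: "real \<Rightarrow> real"
  assumes f: "\<And>t. t \<in> {0..T} \<Longrightarrow> (f has_real_derivative f' t) (at t within {0..T})"
    and f': "\<And>t. t \<in> {a..b} \<Longrightarrow> f' t \<le> 0" and ab: "0 \<le> a" "a \<le> b" "b \<le> T"
  shows "f b \<le> f a"
proof (rule DERIV_nonpos_imp_decreasing_open[OF ab(2)])
  fix t assume "a < t" "t < b"
  then show "\<exists>y. (f has_real_derivative y) (at t) \<and> y \<le> 0"
    using f[of t] f'[of t] ab by (auto simp: at_within_Icc_at)
next
  have "continuous_on {0..T} f"
    using f by (rule DERIV_continuous_on)
  then show "continuous_on {a..b} f" by (rule continuous_on_subset) (use ab in auto)
qed

lemma exponential_decay_within:
  fixes w :: "real \<Rightarrow> real"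
  assumes w: "\<And>t. t \<in> {0..T} \<Longrightarrow> (w has_real_derivative w' t) (at t within {0..T})"
    and w': "\<And>t. t \<in> {a..b} \<Longrightarrow> w' t \<le> - c * w t" and ab: "0 \<le> a" "a \<le> b" "b \<le> T"
  shows "w b \<le> exp (- (c * (b - a))) * w a"
proof -
  have "exp (c * (b - a)) * w b \<le> exp (c * (a - a)) * w a"
  proof (rule nonincreasing_within[OF _ _ ab])
    show "((\<lambda>t. exp (c * (t - a)) * w t) has_real_derivative exp (c * (t - a)) * (w' t + c * w t)) (at t within {0..T})"
      if "t \<in> {0..T}" for t
      using w[OF that] by (auto intro!: derivative_eq_intros simp: algebra_simps)
    show "exp (c * (t - a)) * (w' t + c * w t) \<le> 0" if "t \<in> {a..b}" for t
      using w'[OF that] by (intro mult_nonneg_nonpos) auto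
  qed
  then have "exp (- (c * (b - a))) * (exp (c * (b - a)) * w b) \<le> exp (- (c * (b - a))) * w a"
    by (intro mult_left_mono) auto
  moreover have "exp (- (c * (b - a))) * (exp (c * (b - a)) * w b) = w b"
    by (simp add: mult.assoc[symmetric] exp_add[symmetric])
  ultimately show ?thesis by simp
qed

context even_decreasing_solution
begin

text \<open>
  Take the levels \<open>M - (M / 2) 2\<^sup>-\<^sup>k\<close>. If the \<open>k\<close>-th width is below \<open>A 4\<^sup>-\<^sup>k\<close>, then the next one decays at
  a rate of order \<open>2\<^sup>k\<close> and drops by a factor \<open>4\<close> within a time of order \<open>2\<^sup>-\<^sup>k\<close>; these times are
  summable, but a Lipschitz profile has \<open>k\<close>-th width at least of order \<open>2\<^sup>-\<^sup>k\<close>.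
\<close>

lemma blowup:
  assumes x0: "0 < x0" "\<theta> 0 x0 = \<theta> 0 0 / 2"
    and T_eq: "T = 16 * pi * x0 * ln 4 / \<theta> 0 0"
  shows False
proof -
  define M where "M = \<theta> 0 0"
  have M: "0 < M" using max_pos by (simp add: M_def)
  define b where "b k = M - M / 2 * (1 / 2) ^ k" for k :: nat
  have b_less: "b k < M" "0 < b k" for k
  proof -
    have "(1 / 2 :: real) ^ k \<le> 1" by (intro power_le_one) auto
    then have "M / 2 * (1 / 2) ^ k \<le> M / 2 * 1" using M by (intro mult_left_mono) auto
    then show "0 < b k" using M by (simp add: b_def)
  qed (use M in \<open>simp add: b_def\<close>)
  have "\<exists>x. 0 < x \<and> \<theta> 0 x = b k" for k
    using attains_level[of "b k"] b_less[of k] by (auto simp: M_def)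
  then obtain xi where xi: "\<And>k. 0 < xi k" "\<And>k. \<theta> 0 (xi k) = b k" by metis
  \<comment> \<open>Level 0 is \<open>M / 2\<close> and must be attained at the given
    \<open>x0\<close>, because \<open>A\<close> and \<open>T\<close> are expressed through
    \<open>x0\<close>.\<close>
  define x where "x k = (if k = 0 then x0 else xi k)" for k
  have x: "0 < x k" "\<theta> 0 (x k) = b k" for k
    using xi[of k] x0 by (auto simp: x_def b_def M_def)
  have b_diff: "b (Suc k) - b k = M / 4 * (1 / 2) ^ k" for k by (simp add: b_def field_simps)
  have b_mono: "b k < b (Suc k)" for k
  proof -
    have "0 < M / 4 * (1 / 2) ^ k" using M by simp
    then show ?thesis using b_diff[of k] by linarith
  qed
  have x_less: "x (Suc k) < x k" for k
    using initial_le[of "x k" "x (Suc k)"] x[of k] x[of "Suc k"] b_mono[of k] by (cases "x k \<le> x (Suc k)") auto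
  have "\<exists>X. X 0 = p \<and> curve T X" for p using forward_curve[OF live_T] by metis
  then obtain F where F: "\<And>p. F p 0 = p" "\<And>p. curve T (F p)" by metis
  define r l where "r k = F (x k)" and "l k = F (- x k)" for k
  define w where "w k t = r k t - l k t" for k t
  have r: "r k 0 = x k" "curve T (r k)" and l: "l k 0 = - x k" "curve T (l k)" for k
    by (auto simp: r_def l_def F)
  have w_deriv: "(w k has_real_derivative u t (r k t) - u t (l k t)) (at t within {0..T})" if "t \<in> {0..T}" for k t
    using r(2)[of k] l(2)[of k] that unfolding w_def curve_def by (auto intro: DERIV_diff)
  have order: "l k t < F 0 t" "F 0 t < r k t" if "t \<in> {0..T}" for k t
    using curve_less[OF l(2) F(2) that, of k 0] curve_less[OF F(2) r(2) that, of 0 k]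
      r(1) l(1) F(1) x[of k] b_less[of k] even[of "x k"] by (auto simp: M_def)
  have nested: "l k t < l (Suc k) t" "r (Suc k) t < r k t" if "t \<in> {0..T}" for k t
    using curve_less[OF l(2) l(2) that, of k "Suc k"] curve_less[OF r(2) r(2) that, of "Suc k" k]
      r(1) l(1) x[of k] x[of "Suc k"] x_less[of k] b_mono[of k] even[of "x k"] even[of "x (Suc k)"] by auto
  have w_pos: "0 < w k t" if "t \<in> {0..T}" for k t
    using order[OF that, of k] by (simp add: w_def)
  have w_Suc_le: "w (Suc k) t \<le> w k t" if "t \<in> {0..T}" for k t
    using nested[OF that, of k] by (simp add: w_def)
  \<comment> \<open>Level \<open>Suc k\<close> contracts against the lower level \<open>k\<close>.
    The factor \<open>M / 4 * (1 / 2) ^ k\<close> is the gap of the levels, and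
    \<open>r k t - l (Suc k) t\<close> is replaced by the larger \<open>w k t\<close>.\<close>
  have rate: "u t (r (Suc k) t) - u t (l (Suc k) t) \<le> - (M / (4 * pi) * (1 / 2) ^ k / w k t) * w (Suc k) t"
    if t: "t \<in> {0..T}" for k t
  proof -
    have "pi * (u t (r (Suc k) t) - u t (l (Suc k) t))
      \<le> - ((b (Suc k) - b k) * w (Suc k) t / (r k t - l (Suc k) t))"
      using width_rate[OF r(2)[of "Suc k"] l(2)[of "Suc k"] r(2)[of k] r(1) l(1) r(1) x(1) x_less _ _ t] x(2) b_mono b_less
      by (simp add: w_def M_def)
    also have "\<dots> \<le> - ((b (Suc k) - b k) * w (Suc k) t / w k t)"
    proof -
      have "0 < r k t - l (Suc k) t" "r k t - l (Suc k) t \<le> w k t"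
        using nested[OF t, of k] order[OF t, of "Suc k"] by (auto simp: w_def)
      then show ?thesis
        using b_mono[of k] w_pos[OF t, of "Suc k"]
        by (simp only: neg_le_iff_le) (intro divide_left_mono; simp)
    qed
    also have "\<dots> = pi * (- (M / (4 * pi) * (1 / 2) ^ k / w k t) * w (Suc k) t)"
      unfolding b_diff by simp
    finally show ?thesis using pi_gt_zero by (simp only: mult_le_cancel_left_pos)
  qed
  \<comment> \<open>Level 0 has no predecessor in the sequence, so half of it serves as the lower
    level and only the sign is kept.\<close>
  have rate0: "u t (r 0 t) - u t (l 0 t) \<le> 0" if t: "t \<in> {0..T}" for t
  proof -
    obtain y where y: "0 < y" "\<theta> 0 y = b 0 / 2"
      using attains_level[of "b 0 / 2"] b_less[of 0] unfolding M_def by (smt (verit) field_sum_of_halves)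
    have "x 0 < y" using initial_le[of y "x 0"] y x[of 0] b_less(2)[of 0] by (cases "y \<le> x 0") auto
    then have "pi * (u t (r 0 t) - u t (l 0 t)) \<le> - ((b 0 - b 0 / 2) * (r 0 t - l 0 t) / (F y t - l 0 t))"
      using width_rate[OF r(2)[of 0] l(2)[of 0] F(2)[of y] r(1) l(1) F(1) x(1) \<open>x 0 < y\<close> _ _ t] x(2) y b_less[of 0]
      by (simp add: M_def)
    moreover have "0 < F y t - l 0 t"
      using curve_less[OF r(2) F(2) t, of 0 y] \<open>x 0 < y\<close> order[OF t, of 0] r(1) F(1) x(2) y b_less(2)[of 0] by simp
    moreover have "0 \<le> (b 0 - b 0 / 2) * (r 0 t - l 0 t)"
      using b_less(2)[of 0] order[OF t, of 0] by (intro mult_nonneg_nonneg) auto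
    ultimately have "pi * (u t (r 0 t) - u t (l 0 t)) \<le> 0"
      by (meson divide_nonneg_pos neg_le_0_iff_le order_trans)
    then show ?thesis using pi_gt_zero by (simp add: mult_le_0_iff)
  qed
  define A where "A = 2 * x0"
  have A: "0 < A" using x0 by (simp add: A_def)
  \<comment> \<open>The \<open>k\<close>-th stage lasts \<open>T / 2 * (1 / 2) ^ k\<close>, so all
    stages together fit into \<open>{0..T}\<close>.\<close>
  define \<tau> where "\<tau> k = T * (1 - (1 / 2) ^ k)" for k :: nat
  have \<tau>: "0 \<le> \<tau> k" "\<tau> k \<le> \<tau> (Suc k)" "\<tau> k \<le> T" "\<tau> (Suc k) - \<tau> k = T / 2 * (1 / 2) ^ k" for k
  proof -
    have p: "(1 / 2 :: real) ^ k \<le> 1" "0 \<le> (1 / 2 :: real) ^ k" by (auto intro: power_le_one)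
    show "0 \<le> \<tau> k" using p T_pos by (simp add: \<tau>_def)
    show "\<tau> k \<le> T" using p T_pos by (simp add: \<tau>_def mult_le_cancel_left1)
    show eq: "\<tau> (Suc k) - \<tau> k = T / 2 * (1 / 2) ^ k" by (simp add: \<tau>_def algebra_simps)
    have "0 \<le> T / 2 * (1 / 2) ^ k" using T_pos by simp
    with eq show "\<tau> k \<le> \<tau> (Suc k)" by linarith
  qed
  \<comment> \<open>The bound is stated up to time \<open>T\<close> and not only for stage
    \<open>k\<close>, so that it remains valid while the following widths decay.\<close>
  have collapse: "\<forall>t\<in>{\<tau> k..T}. w k t \<le> A * (1 / 4) ^ k" for k
  proof (induction k)
    case 0
    show ?case
    proof
      fix t assume "t \<in> {\<tau> 0..T}"
      then have t: "0 \<le> t" "t \<le> T" by (auto simp: \<tau>_def)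
      have "w 0 t \<le> w 0 0"
        by (rule nonincreasing_within[OF w_deriv]) (use t rate0 in auto)
      then show "w 0 t \<le> A * (1 / 4) ^ 0" using r(1)[of 0] l(1)[of 0] by (simp add: w_def A_def x_def)
    qed
  next
    case (Suc k)
    \<comment> \<open>The decay rate given by \<open>rate\<close> when \<open>w k t\<close> is
      replaced by its bound \<open>A * (1 / 4) ^ k\<close>.\<close>
    define c where "c = M / (4 * pi * A) * 2 ^ k"
    have c0: "0 < c" using M A by (simp add: c_def)
    have decay: "u t (r (Suc k) t) - u t (l (Suc k) t) \<le> - c * w (Suc k) t" if t: "t \<in> {\<tau> k..T}" for t
    proof -
      have tT: "t \<in> {0..T}" using t \<tau>(1)[of k] by simp
      have "(4 :: real) ^ k = 2 ^ k * 2 ^ k" by (simp add: power_mult_distrib[symmetric])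
      then have "c = M / (4 * pi) * (1 / 2) ^ k / (A * (1 / 4) ^ k)"
        by (simp add: c_def power_divide)
      also have "\<dots> \<le> M / (4 * pi) * (1 / 2) ^ k / w k t"
        using Suc t w_pos[OF tT, of k] M A by (intro divide_left_mono) auto
      finally have "c * w (Suc k) t \<le> M / (4 * pi) * (1 / 2) ^ k / w k t * w (Suc k) t"
        using w_pos[OF tT, of "Suc k"] by (intro mult_right_mono) auto
      then show ?thesis using rate[OF tT, of k] by linarith
    qed
    \<comment> \<open>This equation dictates the value of \<open>T\<close>: rate times duration is
      \<open>M * T / (8 * pi * A)\<close> at every stage, and it has to be \<open>ln 4\<close> for a
      drop by the factor 4.\<close>
    have c\<tau>: "c * (\<tau> (Suc k) - \<tau> k) = ln 4"
    proof -
      have "c * (\<tau> (Suc k) - \<tau> k) = M / (4 * pi * A) * (T / 2) * (2 ^ k * (1 / 2) ^ k)"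
        unfolding \<tau>(4) c_def by simp
      also have "(2 :: real) ^ k * (1 / 2) ^ k = 1" by (simp add: power_mult_distrib[symmetric])
      also have "M / (4 * pi * A) * (T / 2) * 1 = ln 4"
        using M x0(1) unfolding T_eq A_def M_def[symmetric] by (simp add: field_simps)
      finally show ?thesis .
    qed
    show ?case
    proof
      fix t assume t: "t \<in> {\<tau> (Suc k)..T}"
      have "w (Suc k) t \<le> exp (- (c * (t - \<tau> k))) * w (Suc k) (\<tau> k)"
        by (rule exponential_decay_within[OF w_deriv]) (use t \<tau>[of k] decay in auto)
      also have "\<dots> \<le> exp (- ln 4) * (A * (1 / 4) ^ k)"
      proof (rule mult_mono)
        have "ln 4 \<le> c * (t - \<tau> k)"
          unfolding c\<tau>[symmetric] using t c0 by (intro mult_left_mono) auto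
        then show "exp (- (c * (t - \<tau> k))) \<le> exp (- ln 4)" by simp
        have "w (Suc k) (\<tau> k) \<le> w k (\<tau> k)" using w_Suc_le \<tau>[of k] by simp
        also have "\<dots> \<le> A * (1 / 4) ^ k" using Suc \<tau>[of k] by simp
        finally show "w (Suc k) (\<tau> k) \<le> A * (1 / 4) ^ k" .
        show "0 \<le> w (Suc k) (\<tau> k)" using w_pos[of "\<tau> k" "Suc k"] \<tau>[of k] by simp
      qed simp
      also have "\<dots> = A * (1 / 4) ^ Suc k" by (simp add: exp_minus)
      finally show "w (Suc k) t \<le> A * (1 / 4) ^ Suc k" .
    qed
  qed
  have TT: "T \<in> {0..T}" using T_pos by simp
  \<comment> \<open>Between the central curve and \<open>r k\<close> the profile drops by
    \<open>M / 2 * (1 / 2) ^ k\<close> over a distance of at most \<open>A * (1 / 4) ^ k\<close>,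
    against the slope bound \<open>C\<close>.\<close>
  have "M / 2 * 2 ^ k \<le> C * A" for k
  proof -
    have "M / 2 * (1 / 2) ^ k = \<theta> T (F 0 T) - \<theta> T (r k T)"
      using level_value[OF F(2) TT, of 0] level_value[OF r(2) TT, of k] r(1) F(1) x(2) by (simp add: b_def M_def)
    also have "\<dots> \<le> C * \<bar>F 0 T - r k T\<bar>" using Lipschitz[OF TT, of "F 0 T" "r k T"] by linarith
    also have "\<dots> \<le> C * w k T"
      using order[OF TT, of k] C_nonneg by (intro mult_left_mono) (auto simp: w_def)
    also have "\<dots> \<le> C * (A * (1 / 4) ^ k)"
      using collapse[of k] \<tau>(3)[of k] C_nonneg by (intro mult_left_mono) auto
    finally have "4 ^ k * (M / 2 * (1 / 2) ^ k) \<le> 4 ^ k * (C * (A * (1 / 4) ^ k))"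
      by (intro mult_left_mono) auto
    moreover have "(4 :: real) ^ k * (1 / 2) ^ k = 2 ^ k" "(4 :: real) ^ k * (1 / 4) ^ k = 1"
      by (simp_all add: power_mult_distrib[symmetric])
    ultimately show ?thesis by (simp add: mult.assoc mult.left_commute)
  qed
  moreover obtain k where "C * A / (M / 2) < 2 ^ k" using real_arch_pow[of 2 "C * A / (M / 2)"] by auto
  then have "C * A < M / 2 * 2 ^ k" using M by (simp add: divide_less_eq mult.commute)
  ultimately show False by (simp add: not_le[symmetric])
qed

end

section \<open>From bounds at almost every time to bounds at every time\<close>

lemma AE_interval_imp_all:
  fixes g :: "real \<Rightarrow> real"
  assumes ae: "AE t in lborel. t \<in> {0<..<T} \<longrightarrow> g t \<le> C"
    and g: "continuous_on {0..<T} g" and t: "t \<in> {0..<T}"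
  shows "g t \<le> C"
proof (rule ccontr)
  assume "\<not> g t \<le> C"
  then have "\<forall>\<^sub>F s in at t within {0..<T}. C < g s"
    using g t by (auto simp: continuous_on_def order_tendsto_iff)
  then obtain d where d: "0 < d" "\<And>s. s \<in> {0..<T} \<Longrightarrow> s \<noteq> t \<Longrightarrow> dist s t < d \<Longrightarrow> C < g s"
    unfolding eventually_at by blast
  define e where "e = min T (t + d)"
  have te: "t < e" using t d by (auto simp: e_def)
  \<comment> \<open>By continuity a violation at \<open>t\<close> spreads to an interval to its
    right, which has positive measure. Working to the right also covers
    \<open>t = 0\<close>.\<close>
  have "AE s in lborel. s \<notin> {t<..<e}"
    using ae
  proof eventually_elim
    case (elim s)
    show ?case
    proof
      assume "s \<in> {t<..<e}"
      then have "C < g s" "s \<in> {0<..<T}" using t d(2)[of s] by (auto simp: e_def dist_real_def)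
      with elim show False by auto
    qed
  qed
  then have "{t<..<e} \<in> null_sets lborel" by (subst AE_iff_null_sets) auto
  then show False using te by (auto simp: null_sets_def)
qed

lemma global_C1_solution_imp_transport_solution:
  assumes "global_C1_solution \<theta>\<^sub>0 \<theta>" "0 < T"
  obtains \<theta>\<^sub>t \<theta>\<^sub>x u C where "transport_solution \<theta> \<theta>\<^sub>t \<theta>\<^sub>x u T C"
proof -
  have "classical_solution \<theta>\<^sub>0 \<theta>" using assms(1) by (simp add: global_C1_solution_def)
  then obtain \<theta>\<^sub>t \<theta>\<^sub>x u where
    c: "continuous_on ({0..} \<times> UNIV) (\<lambda>(t, x). \<theta> t x)"
      "continuous_on ({0..} \<times> UNIV) (\<lambda>(t, x). \<theta>\<^sub>t t x)"
      "continuous_on ({0..} \<times> UNIV) (\<lambda>(t, x). \<theta>\<^sub>x t x)"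
    and sol: "\<forall>t\<ge>0. \<forall>x.
           ((\<lambda>s. \<theta> s x) has_real_derivative \<theta>\<^sub>t t x) (at t within {0..}) \<and>
           (\<theta> t has_real_derivative \<theta>\<^sub>x t x) (at x) \<and>
           has_Hilbert_transform_at (\<theta> t) (u t x) x \<and>
           \<theta>\<^sub>t t x + u t x * \<theta>\<^sub>x t x = 0"
    unfolding classical_solution_def by blast
  \<comment> \<open>The longer interval puts the final time \<open>T\<close> inside the half-open
    range of \<open>AE_interval_imp_all\<close>.\<close>
  have "Linf_C1 (T + 1) \<theta>" using assms by (simp add: global_C1_solution_def)
  then obtain C where C: "AE t in lborel. t \<in> {0<..<T + 1} \<longrightarrow>
      \<theta> t C1_differentiable_on UNIV \<and> (\<forall>x. \<bar>\<theta> t x\<bar> \<le> C \<and> \<bar>deriv (\<theta> t) x\<bar> \<le> C)"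
    unfolding Linf_C1_def by blast
  have slice: "continuous_on {0..<T + 1} (\<lambda>t. \<bar>h t x\<bar>)"
    if "continuous_on ({0..} \<times> UNIV) (\<lambda>(t, x). h t x)" for h :: "real \<Rightarrow> real \<Rightarrow> real" and x
    by (intro continuous_on_rabs,
        rule continuous_on_compose2[OF that, where f="\<lambda>t. (t, x)", unfolded split_beta, simplified])
      (auto intro!: continuous_intros)
  have "transport_solution \<theta> \<theta>\<^sub>t \<theta>\<^sub>x u T C"
  proof
    fix t x assume t: "t \<in> {0..T}"
    have "AE t in lborel. t \<in> {0<..<T + 1} \<longrightarrow> \<bar>\<theta> t x\<bar> \<le> C"
      using C by eventually_elim auto
    then show "\<bar>\<theta> t x\<bar> \<le> C"
      by (rule AE_interval_imp_all[OF _ slice[OF c(1)]]) (use t in auto)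
    have "AE t in lborel. t \<in> {0<..<T + 1} \<longrightarrow> \<bar>\<theta>\<^sub>x t x\<bar> \<le> C"
      using C
    proof eventually_elim
      case (elim t)
      show ?case
      proof
        assume t: "t \<in> {0<..<T + 1}"
        then have "deriv (\<theta> t) x = \<theta>\<^sub>x t x" using sol by (intro DERIV_imp_deriv) auto
        then show "\<bar>\<theta>\<^sub>x t x\<bar> \<le> C" using elim t by metis
      qed
    qed
    then show "\<bar>\<theta>\<^sub>x t x\<bar> \<le> C"
      by (rule AE_interval_imp_all[OF _ slice[OF c(3)]]) (use t in auto)
    have "((\<lambda>s. \<theta> s x) has_real_derivative \<theta>\<^sub>t t x) (at t within {0..})" using sol t by auto
    then show "((\<lambda>s. \<theta> s x) has_real_derivative \<theta>\<^sub>t t x) (at t within {0..T})"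
      by (rule has_field_derivative_subset) auto
  qed (use assms(2) sol in \<open>auto intro: continuous_on_subset[OF c(1)] continuous_on_subset[OF c(2)] continuous_on_subset[OF c(3)]\<close>)
  then show thesis by (rule that)
qed

theorem theorem4p3:
  fixes \<theta>\<^sub>0 :: "real \<Rightarrow> real"
  assumes "smooth \<theta>\<^sub>0"
    and "\<not> \<theta>\<^sub>0 constant_on UNIV"
    and "(\<theta>\<^sub>0 \<longlongrightarrow> 0) at_infinity"
    and "\<And>x. \<theta>\<^sub>0 (- x) = \<theta>\<^sub>0 x"
    and "\<And>x. \<theta>\<^sub>0 x \<ge> 0"
    and "antimono_on {0<..} \<theta>\<^sub>0"
  shows "\<not> (\<exists>\<theta>. global_C1_solution \<theta>\<^sub>0 \<theta>)"
proof
  assume "\<exists>\<theta>. global_C1_solution \<theta>\<^sub>0 \<theta>"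
  then obtain \<theta> where \<theta>: "global_C1_solution \<theta>\<^sub>0 \<theta>" by blast
  then have init: "\<theta> 0 = \<theta>\<^sub>0"
    by (auto simp: global_C1_solution_def classical_solution_def)
  have data: "even_decreasing_solution \<theta> \<theta>\<^sub>t \<theta>\<^sub>x u T C"
    if "transport_solution \<theta> \<theta>\<^sub>t \<theta>\<^sub>x u T C" for \<theta>\<^sub>t \<theta>\<^sub>x u T C
    using that assms(2-6)
    by (simp add: even_decreasing_solution_def even_decreasing_solution_axioms_def init)
  \<comment> \<open>The length 1 is arbitrary. This instance supplies facts about the datum, from
    which \<open>x0\<close> and \<open>T\<close> are fixed.\<close>
  obtain \<theta>\<^sub>t \<theta>\<^sub>x u C where "transport_solution \<theta> \<theta>\<^sub>t \<theta>\<^sub>x u 1 C"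
    by (rule global_C1_solution_imp_transport_solution[OF \<theta> zero_less_one])
  then interpret unit: even_decreasing_solution \<theta> \<theta>\<^sub>t \<theta>\<^sub>x u 1 C by (rule data)
  obtain x0 where x0: "0 < x0" "\<theta> 0 x0 = \<theta> 0 0 / 2"
    using unit.attains_level[of "\<theta> 0 0 / 2"] unit.max_pos by auto
  define T where "T = 16 * pi * x0 * ln 4 / \<theta> 0 0"
  have "0 < T" using x0(1) unit.max_pos by (simp add: T_def)
  \<comment> \<open>Only now is a bound \<open>C'\<close> chosen, for the interval
    \<open>{0..T}\<close>. It may depend on \<open>T\<close>, which is harmless because
    \<open>T\<close> was computed from the datum alone.\<close>
  then obtain \<theta>\<^sub>t' \<theta>\<^sub>x' u' C' where "transport_solution \<theta> \<theta>\<^sub>t' \<theta>\<^sub>x' u' T C'"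
    using global_C1_solution_imp_transport_solution[OF \<theta>] by blast
  then show False
    by (rule even_decreasing_solution.blowup[OF data x0 T_def])
qed

end
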